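(* Let $k\ge2$, $n_2,\ldots,n_k\in\mathbb{N}\cup\{0\}$ with $\sum_{j}n_j>0$. Then there exist functions $P_m^{(s,N)}(t_1)$, $0\le m\le\sum_{q=2}^k(q-1)n_q$, such that each $t_1^{m-1}P_m^{(s,N)}(t_1)$ is a polynomial in $t_1$ of degree at most $\sum_{q=2}^kqn_q-1$, whose coefficients are polynomials in $N,s$ with degrees in terms of $N$ or $s$ no more than $\sum_{q=2}^k(q-1)n_q$, and such that for every $N\ge 1$, every $s\in\mathbb{C}$ with $\Re(s)>2^{-1}\left(\sum_{q=2}^kqn_q-1\right)$ and all $t_1\ge0$, $$\frac{(-2\mathrm{i})^{-\sum_{q=2}^kqn_q}}{N^{n_2+\cdots+n_k}}\,\mathbb{E}_N^{(s)}\left[e^{-\mathrm{i}t_1\sum_{j=1}^N\frac{\mathsf{x}_j^{(N)}}{N}}\prod_{q=2}^k\left(\sum_{j=1}^N\left(\mathsf{x}_j^{(N)}-\mathrm{i}\right)^q\right)^{n_q}\right]=\frac{1}{t_1^{\sum_{q=2}^kqn_q-1}}\sum_{m=0}^{\sum_{q=2}^k(q-1)n_q}t_1^{m-1}P_m^{(s,N)}(t_1)\frac{d^m}{dt_1^m}\mathbb{E}_N^{(s)}\left[e^{-\mathrm{i}t_1\frac1N\sum_{j=1}^N\mathsf{x}_j^{(N)}}\right],$$ where at $t_1=0$ the right-hand side is understood as its limit as $t_1\downarrow0$.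
   Context: For $N\ge1$, symmetric $f$, and $s\in\mathbb{C}$ for which the integral converges absolutely, $$\mathbb{E}_N^{(s)}\left[f(\mathsf{x}_1^{(N)},\ldots,\mathsf{x}_N^{(N)})\right]=\frac{1}{N!\,\tilde{\mathrm{C}}_N^{(s)}}\int_{\mathbb{R}^N}f(x_1,\ldots,x_N)\prod_{i=1}^N\frac{1}{(1+x_i^2)^{s+N}}\prod_{1\le i<j\le N}(x_i-x_j)^2\,dx_1\cdots dx_N,$$ with $\tilde{\mathrm{C}}_N^{(s)}=\pi^N2^{-N(N+2s-1)}\prod_{j=0}^{N-1}\frac{j!\,\Gamma(2s+N-j)}{\Gamma(s+N-j)^2}$. For real $s\geq 0$ this is a genuine expectation (Cauchy/Hua–Pickrell ensemble); for non-real $s$ the symbol $\mathbb{E}_N^{(s)}$ just denotes this (analytically continued) normalized integral. *)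

theory Defs
  imports "HOL-Analysis.Analysis" "HOL-Computational_Algebra.Polynomial"
begin

definition hua_pickrell_weight :: "complex \<Rightarrow> nat \<Rightarrow> (nat \<Rightarrow> real) \<Rightarrow> complex" where
  "hua_pickrell_weight s N x =
     (\<Prod>i=1..N. 1 / complex_of_real (1 + (x i)\<^sup>2) powr (s + of_nat N)) *
     (\<Prod>i=1..N. \<Prod>j\<in>{i<..N}. complex_of_real ((x i - x j)\<^sup>2))"

definition hua_pickrell_const :: "complex \<Rightarrow> nat \<Rightarrow> complex" where
  "hua_pickrell_const s N =
     of_real pi ^ N * 2 powr (- (of_nat N * (of_nat N + 2 * s - 1))) *
     (\<Prod>j<N. fact j * Gamma (2 * s + of_nat N - of_nat j) / (Gamma (s + of_nat N - of_nat j))\<^sup>2)"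

text \<open>Points of \<open>\<real>\<^sup>N\<close> are functions on \<open>{1..N}\<close>, with the product Lebesgue measure,
  because the dimension varies inside the theorem.  The predicate below expresses absolute
  convergence of the integral; without it, the Bochner integral in
  \<open>hua_pickrell_E\<close> has the default value 0.\<close>

definition hua_pickrell_integrable :: "complex \<Rightarrow> nat \<Rightarrow> ((nat \<Rightarrow> real) \<Rightarrow> complex) \<Rightarrow> bool" where
  "hua_pickrell_integrable s N f \<longleftrightarrow>
     integrable (Pi\<^sub>M {1..N} (\<lambda>_. lborel)) (\<lambda>x. f x * hua_pickrell_weight s N x)"

definition hua_pickrell_E :: "complex \<Rightarrow> nat \<Rightarrow> ((nat \<Rightarrow> real) \<Rightarrow> complex) \<Rightarrow> complex" where
  "hua_pickrell_E s N f =
     1 / (fact N * hua_pickrell_const s N) *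
     (LINT x|Pi\<^sub>M {1..N} (\<lambda>_. lborel). f x * hua_pickrell_weight s N x)"

definition exp_trace :: "nat \<Rightarrow> real \<Rightarrow> (nat \<Rightarrow> real) \<Rightarrow> complex" where
  "exp_trace N t x = exp (- \<i> * complex_of_real t * (\<Sum>j=1..N. complex_of_real (x j) / of_nat N))"

definition shifted_power_sums :: "nat \<Rightarrow> (nat \<Rightarrow> nat) \<Rightarrow> nat \<Rightarrow> (nat \<Rightarrow> real) \<Rightarrow> complex" where
  "shifted_power_sums k n N x =
     (\<Prod>q=2..k. (\<Sum>j=1..N. (complex_of_real (x j) - \<i>) ^ q) ^ n q)"

definition nth_vector_derivative :: "nat \<Rightarrow> (real \<Rightarrow> complex) \<Rightarrow> real \<Rightarrow> complex" where
  "nth_vector_derivative m f = ((\<lambda>g t. vector_derivative g (at t)) ^^ m) f"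

text \<open>\<open>g N s\<close> is a polynomial in \<open>N\<close> and \<open>s\<close> whose degree in each variable separately is at
  most \<open>d\<close>.  In \<open>p\<close> the outer variable is \<open>N\<close> and the inner one is \<open>s\<close>.\<close>

definition poly_in_N_s :: "nat \<Rightarrow> (nat \<Rightarrow> complex \<Rightarrow> complex) \<Rightarrow> bool" where
  "poly_in_N_s d g \<longleftrightarrow>
     (\<exists>p :: complex poly poly. degree p \<le> d \<and> (\<forall>a. degree (coeff p a) \<le> d) \<and>
        (\<forall>N s. g N s = poly (poly p [:of_nat N:]) s))"

end

theory Submission
  imports Defs
begin

text \<open>
  Write \<open>y\<^sub>j = x\<^sub>j - \<i>\<close>, so that \<open>1 + x\<^sub>j\<^sup>2 = y\<^sub>j (y\<^sub>j + 2\<i>)\<close>, and let \<open>u\<^sub>r\<close> be the mean of the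
  \<open>r\<close>-th powers of the \<open>y\<^sub>j\<close>.  A multiset \<open>\<mu>\<close> of exponents gives the observable
  \<open>u\<^sub>\<mu> = \<Prod>r\<in>\<mu>. u\<^sub>r\<close>, and its moment \<open>\<langle>u\<^sub>\<mu>\<rangle>\<close> is its expectation against the character
  \<open>exp (-\<i> t u)\<close> with \<open>u\<close> the mean of the \<open>x\<^sub>j\<close>.  The left-hand side of the theorem is a constant
  multiple of one such moment, of total weight \<open>K = \<Sum>\<mu>\<close>.

  Moments satisfy loop (Schwinger-Dyson) equations.  The vector field
  \<open>V\<^sub>j = y\<^sub>j\<^sup>q + 2\<i> y\<^bsup>q-1\<^esup> = (1 + x\<^sub>j\<^sup>2) y\<^bsup>q-2\<^esup>\<close> (the last two powers are of \<open>y\<^sub>j\<close>) vanishes where the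
  logarithmic derivative of the weight is singular, and its interaction with the squared
  Vandermonde determinant is again polynomial.  Hence the integral of the divergence of
  \<open>V u\<^sub>\<mu>\<close> times the density expands into moments, and it is zero; this is \<open>loop_equation\<close>:
  \<open>\<i>t (u\<^sub>q + 2\<i> u\<^bsub>q-1\<^esub>) u\<^sub>\<mu>\<close> has the same expectation as an explicit combination of observables of
  smaller weight.  So, as long as some exponent \<open>q \<ge> 2\<close> is present, the weight can be
  lowered at the price of at most one factor \<open>1/t\<close>.  When only exponents \<open>0\<close> and \<open>1\<close> remain,
  \<open>u\<^sub>0 = 1\<close> and \<open>u\<^sub>1 = \<i> (\<theta> - 1)\<close>, where multiplication by \<open>\<theta> = -\<i>u\<close> under the expectation is
  differentiation in \<open>t\<close>; the remaining moments are therefore combinations of derivatives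
  of the characteristic function (\<open>moment_ones\<close>).

  What makes the bounds come out is that three quantities attached to \<open>\<mu>\<close> control the result
  and are compatible with each term of the loop equation (\<open>moment_reducible\<close>):

  \<^item> the order of the derivatives is at most \<open>\<Sum>r\<in>\<mu>. \<rho>(r)\<close> with \<open>\<rho>(1) = 1\<close> and \<open>\<rho>(r) = r - 1\<close>
    otherwise, a sum that never increases along the reduction;
  \<^item> the degree of the coefficients in \<open>N\<close> and in \<open>s\<close> is at most \<open>\<Sum>r\<in>\<mu>. (r - 1)\<close>, because every
    term carrying a factor \<open>N\<^sup>2\<close> lowers this sum by at least two and every term carrying \<open>s N\<close>
    lowers it by at least one.  The terms of the loop equation that would violate this cancel, owing to the
    normalisation of \<open>u\<^sub>r\<close> and to the exponent \<open>s + N\<close> of the weight;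
  \<^item> the power of \<open>1/t\<close> is at most \<open>\<Sum>\<mu> - 1\<close>, since each division by \<open>t\<close> lowers the weight and
    divisions occur only at weight at least 2.

  On the analytic side all integrands are polynomials times a product of one-variable
  functions.  The squared Vandermonde determinant has degree \<open>2(N - 1)\<close> in each variable, so a
  polynomial of degree at most \<open>K\<close> in each variable is integrable as soon as
  \<open>2 (Re s + N) - 2 (N - 1) - K > 1\<close>, which is the stated half-plane.  The same count makes
  the boundary terms vanish, allows \<open>K\<close> differentiations under the integral sign, and gives
  continuity at \<open>t = 0\<close>, hence the limit of the right-hand side.
\<close>

section \<open>One-variable integrals\<close>

lemma integrable_one_plus_square_powr:
  fixes p :: real
  assumes "p > 1 / 2"
  shows "integrable lborel (\<lambda>x::real. (1 + x\<^sup>2) powr (- p))"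
proof -
  define h where "h = (\<lambda>x::real. indicator {1..} x * x powr (- 2 * p))"
  have "(\<lambda>x::real. x powr (- 2 * p)) integrable_on {1..}"
    using has_integral_powr_to_inf[of "- 2 * p" 1] assms by (auto simp: integrable_on_def)
  then have "(\<lambda>x::real. x powr (- 2 * p)) absolutely_integrable_on {1..}"
    by (intro nonnegative_absolutely_integrable_1) auto
  then have "integrable (completion lborel) h"
    by (simp add: set_integrable_def h_def)
  then have h: "integrable lborel h"
    by (subst (asm) integrable_completion) (auto simp: h_def)
  then have h': "integrable lborel (\<lambda>x. h (0 + (- 1) * x))"
    by (intro lborel_integrable_real_affine) auto
  have i: "integrable lborel (\<lambda>x::real. indicator {-1..1} x :: real)"
    by (intro integrable_real_indicator) (auto simp: emeasure_lborel_Icc_eq)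
  \<comment> \<open>On the unit interval the integrand is at most 1; outside, it is dominated by the pure power.\<close>
  have dom: "(1 + x\<^sup>2) powr (- p) \<le> indicator {-1..1} x + h x + h (0 + (- 1) * x)" for x
  proof (cases "\<bar>x\<bar> \<le> 1")
    case True
    have "(1 + x\<^sup>2) powr (- p) \<le> 1 powr (- p)"
      using assms by (intro powr_mono2') auto
    also have "\<dots> \<le> indicator {-1..1} x" using True by (auto simp: indicator_def)
    also have "\<dots> \<le> indicator {-1..1} x + h x + h (0 + (- 1) * x)" by (simp add: h_def)
    finally show ?thesis .
  next
    case False
    have "(1 + x\<^sup>2) powr (- p) \<le> (x\<^sup>2) powr (- p)"
      using assms False by (intro powr_mono2') auto
    also have "(x\<^sup>2) powr (- p) = (\<bar>x\<bar> powr 2) powr (- p)" using False by (simp add: powr_numeral)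
    also have "\<dots> = \<bar>x\<bar> powr (- 2 * p)" unfolding powr_powr by simp
    also have "\<dots> \<le> h x + h (0 + (- 1) * x)"
      using False by (cases "x \<ge> 0") (auto simp: h_def indicator_def)
    also have "\<dots> \<le> indicator {-1..1} x + h x + h (0 + (- 1) * x)" by simp
    finally show ?thesis .
  qed
  show ?thesis
  proof (rule Bochner_Integration.integrable_bound)
    show "integrable lborel (\<lambda>x. indicator {-1..1} x + h x + h (0 + (- 1) * x))"
      using h h' i by (intro Bochner_Integration.integrable_add)
    show "AE x in lborel. norm ((1 + x\<^sup>2) powr (- p)) \<le> norm (indicator {-1..1} x + h x + h (0 + (- 1) * x))"
    proof (rule AE_I2)
      fix x :: real
      have "0 \<le> indicator {-1..1} x + h x + h (0 + (- 1) * x)"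
        using dom[of x] by (rule order_trans[rotated]) auto
      then show "norm ((1 + x\<^sup>2) powr (- p)) \<le> norm (indicator {-1..1} x + h x + h (0 + (- 1) * x))"
        using dom[of x] by simp
    qed
  qed auto
qed

text \<open>All integrals in this development factor into integrals of these functions, in which \<open>\<sigma>\<close> will be
  \<open>s + N\<close> and \<open>\<tau>\<close> will be \<open>t / N\<close>.  Expanding in powers of \<open>x - \<i>\<close> rather than of \<open>x\<close> makes their
  norm an exact power of \<open>1 + x\<^sup>2\<close>.\<close>
definition cauchy_factor :: "complex \<Rightarrow> real \<Rightarrow> nat \<Rightarrow> real \<Rightarrow> complex" where
  "cauchy_factor \<sigma> \<tau> a x =
     (of_real x - \<i>) ^ a * (exp (- \<i> * of_real \<tau> * of_real x) * (1 / of_real (1 + x\<^sup>2) powr \<sigma>))"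

lemma one_over_powr_eq_exp:
  "1 / complex_of_real (1 + x\<^sup>2) powr \<sigma> = exp (- \<sigma> * of_real (ln (1 + x\<^sup>2)))"
proof -
  have pos: "0 < 1 + x\<^sup>2" by (smt (verit) zero_le_power2)
  then have "complex_of_real (1 + x\<^sup>2) \<noteq> 0" by (simp only: of_real_eq_0_iff)
  moreover have "Ln (complex_of_real (1 + x\<^sup>2)) = of_real (ln (1 + x\<^sup>2))"
    using pos by (rule Ln_of_real)
  ultimately show ?thesis
    by (simp add: powr_def exp_minus field_simps del: of_real_add of_real_power)
qed

lemma norm_real_minus_i: "norm (complex_of_real x - \<i>) = (1 + x\<^sup>2) powr (1 / 2)"
  by (simp add: cmod_def powr_half_sqrt add.commute)

lemma norm_cauchy_factor: "norm (cauchy_factor \<sigma> \<tau> a x) = (1 + x\<^sup>2) powr (a / 2 - Re \<sigma>)"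
proof -
  have pos: "0 < 1 + x\<^sup>2" by (smt (verit) zero_le_power2)
  have "norm (1 / complex_of_real (1 + x\<^sup>2) powr \<sigma>) = (1 + x\<^sup>2) powr (- Re \<sigma>)"
    unfolding one_over_powr_eq_exp using pos by (simp add: norm_exp_eq_Re powr_def)
  moreover have "norm ((complex_of_real x - \<i>) ^ a) = (1 + x\<^sup>2) powr (a / 2)"
    using pos by (simp add: norm_power norm_real_minus_i powr_power)
  moreover have "norm (exp (- \<i> * of_real \<tau> * complex_of_real x)) = 1"
    by (simp add: norm_exp_eq_Re)
  ultimately show ?thesis
    unfolding cauchy_factor_def norm_mult by (simp add: powr_add[symmetric])
qed

text \<open>The function differentiated here is \<open>1 + x\<^sup>2\<close> times the factor of exponent \<open>a\<close>.  The extra \<open>1 + x\<^sup>2\<close>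
  cancels the denominator of \<open>2x / (1 + x\<^sup>2)\<close> in the logarithmic derivative of the weight, so the
  derivative stays a combination of factors with the same \<open>\<sigma>\<close>.\<close>
lemma has_vector_derivative_cauchy_factor:
  "((\<lambda>x. cauchy_factor \<sigma> \<tau> (a + 2) x + 2 * \<i> * cauchy_factor \<sigma> \<tau> (a + 1) x) has_vector_derivative
     (of_nat (a + 2) * cauchy_factor \<sigma> \<tau> (a + 1) x + 2 * \<i> * of_nat (a + 1) * cauchy_factor \<sigma> \<tau> a x
      - \<sigma> * (2 * cauchy_factor \<sigma> \<tau> (a + 1) x + 2 * \<i> * cauchy_factor \<sigma> \<tau> a x)
      - \<i> * of_real \<tau> * (cauchy_factor \<sigma> \<tau> (a + 2) x + 2 * \<i> * cauchy_factor \<sigma> \<tau> (a + 1) x))) (at x)"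
proof -
  have pos: "0 < 1 + x\<^sup>2" by (smt (verit) zero_le_power2)
  define y where "y = complex_of_real x - \<i>"
  define E where "E = exp (- \<i> * of_real \<tau> * complex_of_real x)"
  define W where "W = exp (- \<sigma> * of_real (ln (1 + x\<^sup>2)))"
  \<comment> \<open>The factorisation on which the choice of the variable \<open>y\<close> rests.\<close>
  have y2: "complex_of_real (1 + x\<^sup>2) = y * (y + 2 * \<i>)"
    by (simp add: y_def algebra_simps power2_eq_square)
  have nz: "y * (y + 2 * \<i>) \<noteq> 0" using pos y2 by (metis less_irrefl of_real_eq_0_iff)
  have 1: "((\<lambda>x. complex_of_real x - \<i>) has_vector_derivative 1) (at x)"
    by (auto intro!: derivative_eq_intros)
  have p: "((\<lambda>x. (complex_of_real x - \<i>) ^ m) has_vector_derivative of_nat m * y ^ (m - 1)) (at x)" for m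
  proof -
    have "((\<lambda>z. z ^ m) has_field_derivative of_nat m * y ^ (m - 1)) (at (complex_of_real x - \<i>))"
      by (auto intro!: derivative_eq_intros simp: y_def)
    from field_vector_diff_chain_at[OF 1 this] show ?thesis by (simp add: o_def)
  qed
  have "((\<lambda>x. - \<i> * of_real \<tau> * complex_of_real x) has_vector_derivative - \<i> * of_real \<tau>) (at x)"
    by (auto intro!: derivative_eq_intros)
  from field_vector_diff_chain_at[OF this DERIV_exp]
  have e: "((\<lambda>x. exp (- \<i> * of_real \<tau> * complex_of_real x)) has_vector_derivative - \<i> * of_real \<tau> * E) (at x)"
    by (simp add: o_def E_def)
  have "((\<lambda>x. ln (1 + x\<^sup>2)) has_real_derivative 2 * x / (1 + x\<^sup>2)) (at x)"
    using pos by (auto intro!: derivative_eq_intros simp: field_simps)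
  then have "((\<lambda>x. complex_of_real (ln (1 + x\<^sup>2))) has_vector_derivative of_real (2 * x / (1 + x\<^sup>2))) (at x)"
    by (intro has_vector_derivative_of_real) (simp add: has_real_derivative_iff_has_vector_derivative)
  then have "((\<lambda>x. - \<sigma> * complex_of_real (ln (1 + x\<^sup>2))) has_vector_derivative - \<sigma> * of_real (2 * x / (1
      + x\<^sup>2))) (at x)"
    by (rule has_vector_derivative_mult_right)
  from field_vector_diff_chain_at[OF this DERIV_exp]
  have w: "((\<lambda>x. exp (- \<sigma> * of_real (ln (1 + x\<^sup>2)))) has_vector_derivative - \<sigma> * of_real (2 * x / (1
      + x\<^sup>2)) * W) (at x)"
    by (simp add: o_def W_def)
  have quot: "complex_of_real (2 * x / (1 + x\<^sup>2)) = (2 * y + 2 * \<i>) / (y * (y + 2 * \<i>))"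
    unfolding of_real_divide y2 by (simp add: y_def)
  have cf: "cauchy_factor \<sigma> \<tau> m x = y ^ m * (E * W)" for m
    unfolding cauchy_factor_def one_over_powr_eq_exp y_def E_def W_def by (rule refl)
  have cf': "cauchy_factor \<sigma> \<tau> m = (\<lambda>x. (complex_of_real x - \<i>) ^ m *
      (exp (- \<i> * of_real \<tau> * complex_of_real x) * exp (- \<sigma> * of_real (ln (1 + x\<^sup>2)))))" for m
    unfolding cauchy_factor_def[abs_def] one_over_powr_eq_exp by (rule refl)
  define d where "d = - \<i> * of_real \<tau> - \<sigma> * ((2 * y + 2 * \<i>) / (y * (y + 2 * \<i>)))"
  have c: "(cauchy_factor \<sigma> \<tau> m has_vector_derivative of_nat m * y ^ (m - 1) * (E * W) + y ^ m * (E * W)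
      * d) (at x)" for m
  proof -
    have "y ^ m * (E * (- \<sigma> * of_real (2 * x / (1 + x\<^sup>2)) * W) + - \<i> * of_real \<tau> * E * W) + of_nat m
        * y ^ (m - 1) * (E * W)
        = of_nat m * y ^ (m - 1) * (E * W) + y ^ m * (E * W) * d"
      unfolding d_def quot[symmetric] by (simp add: algebra_simps)
    note D = has_vector_derivative_mult[OF p[of m] has_vector_derivative_mult[OF e w],
        folded E_def W_def y_def, unfolded this]
    show ?thesis unfolding cf' by (rule D)
  qed
  have quad: "(y ^ (a + 2) + 2 * \<i> * y ^ (a + 1)) * d
      = - \<i> * of_real \<tau> * (y ^ (a + 2) + 2 * \<i> * y ^ (a + 1)) - \<sigma> * (2 * y ^ (a + 1) + 2 * \<i> * y ^ a)"
  proof -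
    have f: "y ^ (a + 2) + 2 * \<i> * y ^ (a + 1) = y ^ a * (y * (y + 2 * \<i>))"
      by (simp add: algebra_simps power2_eq_square)
    have "(y ^ (a + 2) + 2 * \<i> * y ^ (a + 1)) * d =
      - \<i> * of_real \<tau> * (y ^ a * (y * (y + 2 * \<i>))) - \<sigma> * y ^ a * (2 * y + 2 * \<i>)"
      unfolding f d_def using nz by (simp add: right_diff_distrib)
    then show ?thesis unfolding f by (simp add: algebra_simps)
  qed
  have "of_nat (a + 2) * y ^ (a + 2 - 1) * (E * W) + y ^ (a + 2) * (E * W) * d
      + 2 * \<i> * (of_nat (a + 1) * y ^ (a + 1 - 1) * (E * W) + y ^ (a + 1) * (E * W) * d)
      = (of_nat (a + 2) * y ^ (a + 1) + 2 * \<i> * of_nat (a + 1) * y ^ a) * (E * W)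
        + ((y ^ (a + 2) + 2 * \<i> * y ^ (a + 1)) * d) * (E * W)"
    by (simp add: algebra_simps)
  also have "\<dots> = of_nat (a + 2) * cauchy_factor \<sigma> \<tau> (a + 1) x + 2 * \<i> * of_nat (a + 1) * cauchy_factor \<sigma> \<tau> a x
      - \<sigma> * (2 * cauchy_factor \<sigma> \<tau> (a + 1) x + 2 * \<i> * cauchy_factor \<sigma> \<tau> a x)
      - \<i> * of_real \<tau> * (cauchy_factor \<sigma> \<tau> (a + 2) x + 2 * \<i> * cauchy_factor \<sigma> \<tau> (a + 1) x)"
    unfolding quad cf by (simp add: ring_distribs mult_ac)
  finally show ?thesis
    using has_vector_derivative_add[OF c[of "a + 2"] has_vector_derivative_mult_right[OF c[of "a
        + 1"], of "2 * \<i>"]]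
    by simp
qed

lemma measurable_cauchy_factor [measurable]: "cauchy_factor \<sigma> \<tau> a \<in> borel_measurable borel"
  unfolding cauchy_factor_def[abs_def] one_over_powr_eq_exp by measurable

lemma isCont_cauchy_factor: "isCont (cauchy_factor \<sigma> \<tau> a) x"
proof -
  have "1 + x\<^sup>2 \<noteq> 0" by (smt (verit) zero_le_power2)
  then show ?thesis
    unfolding cauchy_factor_def[abs_def] one_over_powr_eq_exp by (intro continuous_intros) auto
qed

lemma integrable_cauchy_factor:
  assumes "real a - 2 * Re \<sigma> < -1"
  shows "integrable lborel (cauchy_factor \<sigma> \<tau> a)"
proof (rule Bochner_Integration.integrable_bound)
  show "integrable lborel (\<lambda>x::real. (1 + x\<^sup>2) powr (- (Re \<sigma> - a / 2)))"
    using assms by (intro integrable_one_plus_square_powr) auto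
qed (auto simp: norm_cauchy_factor)

lemma tendsto_cauchy_factor:
  assumes "real a - 2 * Re \<sigma> < 0"
  shows "(cauchy_factor \<sigma> \<tau> a \<longlongrightarrow> 0) at_top" "(cauchy_factor \<sigma> \<tau> a \<longlongrightarrow> 0) at_bot"
proof -
  have L: "((\<lambda>u::real. u powr (a / 2 - Re \<sigma>)) \<longlongrightarrow> 0) at_top"
    using assms by (intro tendsto_neg_powr[OF _ filterlim_ident]) simp
  have g: "filterlim (\<lambda>x::real. 1 + x\<^sup>2) at_top at_top" 
    by (rule filterlim_tendsto_add_at_top[OF tendsto_const filterlim_pow_at_top[OF _ filterlim_ident]]) simp
  have h: "filterlim (\<lambda>x::real. 1 + x\<^sup>2) at_top at_bot"
    unfolding filterlim_at_bot_mirror using g by simp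
  show "(cauchy_factor \<sigma> \<tau> a \<longlongrightarrow> 0) at_top"
    by (rule tendsto_norm_zero_cancel) (unfold norm_cauchy_factor, rule filterlim_compose[OF L g])
  show "(cauchy_factor \<sigma> \<tau> a \<longlongrightarrow> 0) at_bot"
    by (rule tendsto_norm_zero_cancel) (unfold norm_cauchy_factor, rule filterlim_compose[OF L h])
qed

text \<open>The only integration by parts in the proof; the statements in several variables reduce to it
  through the product structure.  The hypothesis is what integrability of the top exponent \<open>a + 2\<close>
  requires; it also makes the boundary terms vanish.\<close>
lemma integral_by_parts_cauchy_factor:
  assumes "real (a + 2) - 2 * Re \<sigma> < -1"
  shows "(LINT x|lborel. of_nat (a + 2) * cauchy_factor \<sigma> \<tau> (a + 1) x
        + 2 * \<i> * of_nat (a + 1) * cauchy_factor \<sigma> \<tau> a x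
        - \<sigma> * (2 * cauchy_factor \<sigma> \<tau> (a + 1) x + 2 * \<i> * cauchy_factor \<sigma> \<tau> a x)
        - \<i> * of_real \<tau> * (cauchy_factor \<sigma> \<tau> (a + 2) x + 2 * \<i> * cauchy_factor \<sigma> \<tau> (a + 1) x)) = 0"
    (is "(LINT x|lborel. ?f x) = 0")
proof -
  let ?F = "\<lambda>x. cauchy_factor \<sigma> \<tau> (a + 2) x + 2 * \<i> * cauchy_factor \<sigma> \<tau> (a + 1) x"
  have int: "integrable lborel ?f"
    using assms
    by (intro Bochner_Integration.integrable_add Bochner_Integration.integrable_diff
        integrable_mult_right integrable_cauchy_factor) auto
  have lim: "(?F \<longlongrightarrow> 0) at_top" "(?F \<longlongrightarrow> 0) at_bot"
    by (intro tendsto_add_zero tendsto_mult_right_zero tendsto_cauchy_factor; use assms in simp)+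
  have "(LBINT x=-\<infinity>..\<infinity>. ?f x) = 0 - 0"
  proof (rule interval_integral_FTC_integrable[where F = ?F])
    show "(?F has_vector_derivative ?f x) (at x)" for x
      by (rule has_vector_derivative_cauchy_factor)
    show "isCont ?f x" for x
      by (intro continuous_intros isCont_cauchy_factor)
    show "set_integrable lborel (einterval (-\<infinity>) \<infinity>) ?f"
      using int by (simp add: set_integrable_def)
    show "((?F \<circ> real_of_ereal) \<longlongrightarrow> 0) (at_right (-\<infinity>))"
      using lim(2) by (simp add: ereal_tendsto_simps)
    show "((?F \<circ> real_of_ereal) \<longlongrightarrow> 0) (at_left \<infinity>)"
      using lim(1) by (simp add: ereal_tendsto_simps)
  qed simp
  then show ?thesis
    by (simp add: interval_integral_to_infinity_eq interval_lebesgue_integral_def set_lebesgue_integral_def)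
qed

section \<open>Polynomials and their derivative along a vector field\<close>

definition shifted_monomial :: "nat \<Rightarrow> (nat \<Rightarrow> nat) \<Rightarrow> (nat \<Rightarrow> real) \<Rightarrow> complex" where
  "shifted_monomial N a x = (\<Prod>i=1..N. (of_real (x i) - \<i>) ^ a i)"

text \<open>For the field \<open>V = y\<^sup>q + 2\<i> y\<^bsup>q-1\<^esup>\<close> with \<open>q \<ge> 2\<close> this is \<open>V / y\<close>, the derivative of \<open>log y\<close> along \<open>V\<close>.
  That it is a polynomial is the reason why monomials are convenient generators.\<close>
definition log_field :: "nat \<Rightarrow> real \<Rightarrow> complex" where
  "log_field q r = (of_real r - \<i>) ^ (q - 1) + 2 * \<i> * (of_real r - \<i>) ^ (q - 2)"

text \<open>The function \<open>f\<close> is a polynomial in \<open>x\<^sub>1, \<dots>, x\<^sub>N\<close> of degree at most \<open>d i\<close> in \<open>x\<^sub>i\<close>, and \<open>g\<close> is its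
  derivative \<open>\<Sum>j. V\<^sub>j \<partial>\<^sub>j f\<close>.  Generating the pairs from monomials gives the derivative without any
  partial derivatives: along \<open>V\<close> a monomial is multiplied by the sum of its exponents weighted
  with the logarithmic field, and since exponents add under multiplication the product rule
  (\<open>flow_poly_mult\<close>) is immediate.  The degree is recorded per variable because the Vandermonde
  factor has degree \<open>2(N - 1)\<close> in each variable but a much larger total degree.\<close>
inductive flow_poly ::
  "nat \<Rightarrow> nat \<Rightarrow> (nat \<Rightarrow> nat) \<Rightarrow> ((nat \<Rightarrow> real) \<Rightarrow> complex) \<Rightarrow> ((nat \<Rightarrow> real) \<Rightarrow> complex) \<Rightarrow> bool"
  for N q :: nat where
  monomial: "(\<And>i. i \<in> {1..N} \<Longrightarrow> a i \<le> d i) \<Longrightarrow>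
    flow_poly N q d (\<lambda>x. c * shifted_monomial N a x)
      (\<lambda>x. c * shifted_monomial N a x * (\<Sum>j=1..N. of_nat (a j) * log_field q (x j)))"
| add: "flow_poly N q d f g \<Longrightarrow> flow_poly N q d f' g' \<Longrightarrow>
    flow_poly N q d (\<lambda>x. f x + f' x) (\<lambda>x. g x + g' x)"

lemma shifted_monomial_add:
  "shifted_monomial N (\<lambda>i. a i + b i) x = shifted_monomial N a x * shifted_monomial N b x"
  by (simp add: shifted_monomial_def power_add prod.distrib)

lemma flow_poly_mult_monomial:
  assumes "flow_poly N q d f g" "\<And>i. i \<in> {1..N} \<Longrightarrow> b i \<le> e i"
  shows "flow_poly N q (\<lambda>i. d i + e i) (\<lambda>x. f x * (c * shifted_monomial N b x))
    (\<lambda>x. g x * (c * shifted_monomial N b x) + f x *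
       (c * shifted_monomial N b x * (\<Sum>j=1..N. of_nat (b j) * log_field q (x j))))"
  using assms
proof induction
  case (monomial a d c')
  have "flow_poly N q (\<lambda>i. d i + e i) (\<lambda>x. (c' * c) * shifted_monomial N (\<lambda>i. a i + b i) x)
      (\<lambda>x. (c' * c) * shifted_monomial N (\<lambda>i. a i + b i) x *
         (\<Sum>j=1..N. of_nat (a j + b j) * log_field q (x j)))"
    using monomial by (intro flow_poly.monomial add_mono)
  then show ?case
    by (simp add: shifted_monomial_add sum.distrib algebra_simps)
next
  case (add d f g f' g')
  from flow_poly.add[OF add.IH(1)[OF add.prems] add.IH(2)[OF add.prems]]
  show ?case by (simp add: algebra_simps)
qed

lemma flow_poly_mult:
  assumes "flow_poly N q e f' g'" "flow_poly N q d f g"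
  shows "flow_poly N q (\<lambda>i. d i + e i) (\<lambda>x. f x * f' x) (\<lambda>x. g x * f' x + f x * g' x)"
  using assms
proof induction
  case (monomial a e c)
  then show ?case by (intro flow_poly_mult_monomial)
next
  case (add e f1 g1 f2 g2)
  from flow_poly.add[OF add.IH(1)[OF add.prems] add.IH(2)[OF add.prems]]
  show ?case by (simp add: algebra_simps)
qed

lemma flow_poly_cong_degree:
  assumes "flow_poly N q d f g" "\<And>i. i \<in> {1..N} \<Longrightarrow> d i \<le> e i"
  shows "flow_poly N q e f g"
  using assms
proof induction
  case (monomial a d c)
  then show ?case by (intro flow_poly.monomial) (meson order_trans)
next
  case (add d f1 g1 f2 g2)
  then show ?case by (blast intro: flow_poly.add)
qed

lemma flow_poly_const: "flow_poly N q d (\<lambda>x. c) (\<lambda>x. 0)"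
  using flow_poly.monomial[of N "\<lambda>_. 0" d q c] by (simp add: shifted_monomial_def)

lemma flow_poly_cmult:
  assumes "flow_poly N q d f g"
  shows "flow_poly N q d (\<lambda>x. c * f x) (\<lambda>x. c * g x)"
  using flow_poly_mult[OF assms flow_poly_const[of N q "\<lambda>_. 0" c]] by simp

lemma flow_poly_sum:
  assumes "\<And>i. i \<in> A \<Longrightarrow> flow_poly N q d (f i) (g i)"
  shows "flow_poly N q d (\<lambda>x. \<Sum>i\<in>A. f i x) (\<lambda>x. \<Sum>i\<in>A. g i x)"
  using assms
  by (induction A rule: infinite_finite_induct) (auto intro: flow_poly_const flow_poly.add)

lemma flow_poly_prod:
  assumes "finite A" "\<And>i. i \<in> A \<Longrightarrow> flow_poly N q (d i) (f i) (\<lambda>x. f i x * h i x)"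
  shows "flow_poly N q (\<lambda>k. \<Sum>i\<in>A. d i k) (\<lambda>x. \<Prod>i\<in>A. f i x) (\<lambda>x. (\<Prod>i\<in>A. f i x) * (\<Sum>i\<in>A. h i x))"
  using assms
proof (induction A)
  case empty
  show ?case using flow_poly_const[of N q "\<lambda>k. 0" 1] by simp
next
  case (insert i A)
  have "flow_poly N q (\<lambda>k. d i k + (\<Sum>i\<in>A. d i k)) (\<lambda>x. f i x * (\<Prod>i\<in>A. f i x))
      (\<lambda>x. f i x * h i x * (\<Prod>i\<in>A. f i x) + f i x * ((\<Prod>i\<in>A. f i x) * (\<Sum>i\<in>A. h i x)))"
    using insert by (intro flow_poly_mult) auto
  then show ?case using insert.hyps by (simp add: algebra_simps)
qed

lemma flow_poly_power_coord:
  assumes "j \<in> {1..N}" "q \<ge> 2"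
  shows "flow_poly N q (\<lambda>i. if i = j then r else 0) (\<lambda>x. (of_real (x j) - \<i>) ^ r)
    (\<lambda>x. of_nat r * ((of_real (x j) - \<i>) ^ (r + q - 1) + 2 * \<i> * (of_real (x j) - \<i>) ^ (r + q - 2)))"
proof -
  let ?a = "\<lambda>i. if i = j then r else 0"
  have m: "shifted_monomial N ?a x = (of_real (x j) - \<i>) ^ r" for x
  proof -
    have "shifted_monomial N ?a x = (\<Prod>i=1..N. if i = j then (of_real (x i) - \<i>) ^ r else 1)"
      unfolding shifted_monomial_def by (intro prod.cong) auto
    then show ?thesis using assms by simp
  qed
  have s: "(\<Sum>i=1..N. of_nat (?a i) * log_field q (x i)) = of_nat r * log_field q (x j)" for x
  proof -
    have "(\<Sum>i=1..N. of_nat (?a i) * log_field q (x i))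
        = (\<Sum>i=1..N. if i = j then of_nat r * log_field q (x i) else 0)"
      by (intro sum.cong) auto
    then show ?thesis using assms by simp
  qed
  obtain p where q: "q = Suc (Suc p)" using assms(2) by (metis add_2_eq_Suc le_Suc_ex)
  show ?thesis
    using flow_poly.monomial[of N ?a ?a q 1, OF order_refl] unfolding m s
    by (simp add: log_field_def q power_add algebra_simps)
qed

section \<open>The squared Vandermonde determinant\<close>

lemma sum_pairs_symmetric:
  fixes h :: "nat \<Rightarrow> nat \<Rightarrow> 'a::comm_semiring_1"
  assumes "\<And>i j. h i j = h j i"
  shows "(\<Sum>i=1..N. \<Sum>j\<in>{i<..N}. 2 * h i j) + (\<Sum>i=1..N. h i i) = (\<Sum>i=1..N. \<Sum>j=1..N. h i j)"
proof (induction N)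
  case (Suc N)
  have "(\<Sum>i=1..N. \<Sum>j\<in>{i<..Suc N}. 2 * h i j) = (\<Sum>i=1..N. 2 * h i (Suc N) + (\<Sum>j\<in>{i<..N}. 2 * h i j))"
  proof (rule sum.cong[OF refl])
    fix i assume "i \<in> {1..N}"
    then have "{i<..Suc N} = insert (Suc N) {i<..N}" by auto
    then show "(\<Sum>j\<in>{i<..Suc N}. 2 * h i j) = 2 * h i (Suc N) + (\<Sum>j\<in>{i<..N}. 2 * h i j)"
      by simp
  qed
  moreover have "(\<Sum>i=1..N. h i (Suc N)) = (\<Sum>i=1..N. h (Suc N) i)"
    by (intro sum.cong refl assms)
  ultimately show ?case
    using Suc by (simp add: sum.distrib sum_distrib_left[symmetric] mult_2 algebra_simps)
qed simp

definition vandermonde_square :: "nat \<Rightarrow> (nat \<Rightarrow> real) \<Rightarrow> complex" where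
  "vandermonde_square N x = (\<Prod>i=1..N. \<Prod>j\<in>{i<..N}. complex_of_real ((x i - x j)\<^sup>2))"

definition power_sum :: "nat \<Rightarrow> nat \<Rightarrow> (nat \<Rightarrow> real) \<Rightarrow> complex" where
  "power_sum N r x = (\<Sum>j=1..N. (of_real (x j) - \<i>) ^ r)"

text \<open>The quotient of \<open>y\<^sup>m - z\<^sup>m\<close> by \<open>y - z\<close>, written as a polynomial so that coinciding points need no
  separate treatment.\<close>
definition divided_diff :: "nat \<Rightarrow> complex \<Rightarrow> complex \<Rightarrow> complex" where
  "divided_diff m y z = (\<Sum>a<m. y ^ a * z ^ (m - Suc a))"

lemma divided_diff: "(y - z) * divided_diff m y z = y ^ m - z ^ m"
  unfolding divided_diff_def by (subst power_diff_sumr2) (simp add: mult.commute)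

lemma divided_diff_sym: "divided_diff m y z = divided_diff m z y"
  unfolding divided_diff_def
  by (rule sum.reindex_bij_witness[of _ "\<lambda>a. m - Suc a" "\<lambda>a. m - Suc a"]) (auto simp: mult.commute)

lemma divided_diff_diag: "divided_diff m y y = of_nat m * y ^ (m - 1)"
proof -
  have "divided_diff m y y = (\<Sum>a<m. y ^ (m - 1))"
    unfolding divided_diff_def by (intro sum.cong refl) (auto simp: power_add[symmetric])
  then show ?thesis by simp
qed

lemma sum_divided_diff:
  "(\<Sum>i=1..N. \<Sum>j=1..N. divided_diff m (of_real (x i) - \<i>) (of_real (x j) - \<i>))
     = (\<Sum>a<m. power_sum N a x * power_sum N (m - Suc a) x)"
proof -
  have "(\<Sum>j=1..N. \<Sum>a<m. f i j a) = (\<Sum>a<m. \<Sum>j=1..N. f i j a)" for i and f :: "nat \<Rightarrow> nat \<Rightarrow> nat \<Rightarrow> complex"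
    by (rule sum.swap)
  moreover have "(\<Sum>i=1..N. \<Sum>a<m. g i a) = (\<Sum>a<m. \<Sum>i=1..N. g i a)" for g :: "nat \<Rightarrow> nat \<Rightarrow> complex"
    by (rule sum.swap)
  ultimately show ?thesis
    unfolding divided_diff_def power_sum_def sum_product by (simp only:)
qed

text \<open>Along \<open>V\<close> the factor \<open>(x\<^sub>i - x\<^sub>j)\<^sup>2\<close> is multiplied by \<open>2 (V\<^sub>i - V\<^sub>j) / (x\<^sub>i - x\<^sub>j)\<close>, a divided difference.
  Summed over pairs, these symmetric polynomials give products of two power sums minus the
  contribution of the diagonal; the latter will cancel the divergence of \<open>V\<close> itself.\<close>
lemma flow_poly_vandermonde:
  assumes "q \<ge> 2"
  shows "flow_poly N q (\<lambda>_. 2 * (N - 1)) (vandermonde_square N)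
    (\<lambda>x. vandermonde_square N x *
      ((\<Sum>a<q. power_sum N a x * power_sum N (q - Suc a) x) - of_nat q * power_sum N (q - 1) x
       + 2 * \<i> * ((\<Sum>a<q-1. power_sum N a x * power_sum N (q - 1 - Suc a) x)
            - of_nat (q - 1) * power_sum N (q - 2) x)))"
proof -
  define h where "h = (\<lambda>(x::nat \<Rightarrow> real) i j. divided_diff q (of_real (x i) - \<i>) (of_real (x j) - \<i>)
     + 2 * \<i> * divided_diff (q - 1) (of_real (x i) - \<i>) (of_real (x j) - \<i>))"
  \<comment> \<open>The degree of a difference of two coordinates, with value 2 on the diagonal, so that summing
    it over pairs is an instance of the same symmetric summation as for the logarithmic derivative.\<close>
  define e :: "nat \<Rightarrow> nat \<Rightarrow> nat \<Rightarrow> nat" where "e = (\<lambda>i j k. (if k = i then 1 else 0) + (if k = j then 1 else 0))"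
  have pair: "flow_poly N q (\<lambda>k. 2 * e i j k) (\<lambda>x. complex_of_real ((x i - x j)\<^sup>2))
      (\<lambda>x. complex_of_real ((x i - x j)\<^sup>2) * (2 * h x i j))"
    if ij: "i \<in> {1..N}" "j \<in> {1..N}" for i j
  proof -
    have 1: "flow_poly N q (e i j) (\<lambda>x. (of_real (x l) - \<i>))
      (\<lambda>x. (of_real (x l) - \<i>) ^ q + 2 * \<i> * (of_real (x l) - \<i>) ^ (q - 1))" 
      if "l \<in> {i, j}" for l
    proof (rule flow_poly_cong_degree)
      show "flow_poly N q (\<lambda>i. if i = l then 1 else 0) (\<lambda>x. (of_real (x l) - \<i>))
        (\<lambda>x. (of_real (x l) - \<i>) ^ q + 2 * \<i> * (of_real (x l) - \<i>) ^ (q - 1))"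
        using flow_poly_power_coord[of l N q 1] that ij assms by auto
    qed (use that in \<open>auto simp: e_def\<close>)
    have 2: "flow_poly N q (e i j) (\<lambda>x. (of_real (x i) - \<i>) + (- 1) * (of_real (x j) - \<i>))
      (\<lambda>x. ((of_real (x i) - \<i>) ^ q + 2 * \<i> * (of_real (x i) - \<i>) ^ (q - 1))
         + (- 1) * ((of_real (x j) - \<i>) ^ q + 2 * \<i> * (of_real (x j) - \<i>) ^ (q - 1)))"
      by (intro flow_poly.add flow_poly_cmult 1) auto
    have 3: "((of_real (x i) - \<i>) ^ q + 2 * \<i> * (of_real (x i) - \<i>) ^ (q - 1))
         + (- 1) * ((of_real (x j) - \<i>) ^ q + 2 * \<i> * (of_real (x j) - \<i>) ^ (q - 1))
       = (complex_of_real (x i) - of_real (x j)) * h x i j" for x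
    proof -
      have "(complex_of_real (x i) - of_real (x j)) * h x i j =
        ((of_real (x i) - \<i>) - (of_real (x j) - \<i>)) * divided_diff q (of_real (x i) - \<i>) (of_real (x j) - \<i>)
        + 2 * \<i> * (((of_real (x i) - \<i>) - (of_real (x j) - \<i>))
            * divided_diff (q - 1) (of_real (x i) - \<i>) (of_real (x j) - \<i>))"
        by (simp add: h_def algebra_simps)
      then show ?thesis unfolding divided_diff by (simp add: algebra_simps)
    qed
    have 4: "(of_real (x i) - \<i>) + (- 1) * (of_real (x j) - \<i>) = complex_of_real (x i) - of_real (x j)" for x
      by simp
    have 5: "complex_of_real ((x i - x j)\<^sup>2) = (of_real (x i) - of_real (x j))
        * (of_real (x i) - of_real (x j))" for x
      by (simp add: power2_eq_square)
    have 6: "(complex_of_real (x i) - of_real (x j)) * h x i j * (of_real (x i) - of_real (x j))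
        + (of_real (x i) - of_real (x j)) * ((of_real (x i) - of_real (x j)) * h x i j)
      = (of_real (x i) - of_real (x j)) * (of_real (x i) - of_real (x j)) * (2 * h x i j)" for x
      by (simp add: mult_ac)
    from flow_poly_mult[OF 2 2] show ?thesis
      unfolding 3 4 5 6 mult_2[where 'a = nat] .
  qed
  have sym: "h x i j = h x j i" for x i j
    unfolding h_def
    by (intro arg_cong2[where f = "(+)"] arg_cong2[where f = "(*)"] refl divided_diff_sym)
  have deg: "(\<Sum>i=1..N. \<Sum>j\<in>{i<..N}. 2 * e i j k) \<le> 2 * (N - 1)" if "k \<in> {1..N}" for k
  proof -
    have "(\<Sum>i=1..N. \<Sum>j\<in>{i<..N}. 2 * e i j k) + (\<Sum>i=1..N. e i i k) = (\<Sum>i=1..N. \<Sum>j=1..N. e i j k)"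
      by (rule sum_pairs_symmetric) (simp add: e_def)
    moreover have "(\<Sum>i=1..N. e i i k) = 2" 
      using that by (simp add: e_def sum.distrib)
    moreover have "(\<Sum>i=1..N. \<Sum>j=1..N. e i j k) = 2 * N"
    proof -
      have "(\<Sum>i=1..N. \<Sum>j=1..N. if k = i then 1 else 0) = (\<Sum>i=1..N. if k = i then N else 0)"
        by (intro sum.cong) auto
      then show ?thesis using that unfolding e_def sum.distrib by simp
    qed
    ultimately show ?thesis by simp
  qed
  have total: "(\<Sum>i=1..N. \<Sum>j\<in>{i<..N}. 2 * h x i j) =
      ((\<Sum>a<q. power_sum N a x * power_sum N (q - Suc a) x) - of_nat q * power_sum N (q - 1) x
       + 2 * \<i> * ((\<Sum>a<q-1. power_sum N a x * power_sum N (q - 1 - Suc a) x)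
            - of_nat (q - 1) * power_sum N (q - 2) x))" for x
  proof -
    have "(\<Sum>i=1..N. \<Sum>j=1..N. h x i j) =
       (\<Sum>a<q. power_sum N a x * power_sum N (q - Suc a) x)
       + 2 * \<i> * (\<Sum>a<q-1. power_sum N a x * power_sum N (q - 1 - Suc a) x)"
      unfolding h_def sum.distrib sum_distrib_left[symmetric] sum_divided_diff ..
    moreover have "(\<Sum>i=1..N. h x i i) = of_nat q * power_sum N (q - 1) x
       + 2 * \<i> * (of_nat (q - 1) * power_sum N (q - 2) x)"
      unfolding h_def sum.distrib sum_distrib_left[symmetric] divided_diff_diag power_sum_def
      by (simp add: numeral_2_eq_2)
    moreover note sum_pairs_symmetric[of "h x" N, OF sym]
    ultimately show ?thesis by (simp add: algebra_simps)
  qed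
  have "flow_poly N q (\<lambda>k. \<Sum>i=1..N. \<Sum>j\<in>{i<..N}. 2 * e i j k) (vandermonde_square N)
     (\<lambda>x. vandermonde_square N x * (\<Sum>i=1..N. \<Sum>j\<in>{i<..N}. 2 * h x i j))"
    unfolding vandermonde_square_def[abs_def]
    by (intro flow_poly_prod pair) auto
  then show ?thesis
    unfolding total by (rule flow_poly_cong_degree) (rule deg)
qed

section \<open>Integration by parts in several variables\<close>

definition cauchy_weight :: "nat \<Rightarrow> complex \<Rightarrow> real \<Rightarrow> (nat \<Rightarrow> real) \<Rightarrow> complex" where
  "cauchy_weight N \<sigma> \<tau> x =
     (\<Prod>i=1..N. exp (- \<i> * of_real \<tau> * of_real (x i)) * (1 / of_real (1 + (x i)\<^sup>2) powr \<sigma>))"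

lemma shifted_monomial_times_weight:
  "shifted_monomial N a x * cauchy_weight N \<sigma> \<tau> x = (\<Prod>i=1..N. cauchy_factor \<sigma> \<tau> (a i) (x i))"
  unfolding shifted_monomial_def cauchy_weight_def cauchy_factor_def prod.distrib[symmetric]
  by (rule refl)

interpretation lborel_product: product_sigma_finite "\<lambda>_::nat. lborel :: real measure"
  by standard

lemma flow_poly_integrable:
  assumes "flow_poly N q d f g" "\<And>i. i \<in> {1..N} \<Longrightarrow> real (d i) - 2 * Re \<sigma> < -1"
  shows "integrable (Pi\<^sub>M {1..N} (\<lambda>_. lborel)) (\<lambda>x. f x * cauchy_weight N \<sigma> \<tau> x)"
  using assms
proof induction
  case (monomial a d c)
  have "integrable (Pi\<^sub>M {1..N} (\<lambda>_. lborel)) (\<lambda>x. \<Prod>i=1..N. cauchy_factor \<sigma> \<tau> (a i) (x i))"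
  proof (intro lborel_product.product_integrable_prod integrable_cauchy_factor finite_atLeastAtMost)
    fix i assume "i \<in> {1..N}"
    with monomial have "a i \<le> d i" "real (d i) - 2 * Re \<sigma> < -1" by auto
    then show "real (a i) - 2 * Re \<sigma> < -1" by linarith
  qed
  then show ?case
    by (simp add: shifted_monomial_times_weight mult.assoc)
next
  case (add d f g f' g')
  then show ?case by (simp add: distrib_right)
qed

text \<open>The function \<open>T\<close> is the divergence of \<open>V\<close> plus the derivative along \<open>V\<close> of the logarithm of the weight, so
  the integrand is the divergence of the product of \<open>f\<close>, \<open>V\<close> and the weight.  For a monomial it is a sum over \<open>j\<close> of
  products of one-variable functions, the \<open>j\<close>-th factor of which has integral zero.\<close>
lemma flow_poly_integral_by_parts:
  fixes \<tau> :: real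
  assumes "flow_poly N q d f g" "\<And>i. i \<in> {1..N} \<Longrightarrow> real (d i + q) - 2 * Re \<sigma> < -1" "q \<ge> 2"
  defines "T \<equiv> \<lambda>x. of_nat q * power_sum N (q - 1) x + 2 * \<i> * of_nat (q - 1) * power_sum N (q - 2) x
      - \<sigma> * (2 * power_sum N (q - 1) x + 2 * \<i> * power_sum N (q - 2) x)
      - \<i> * of_real \<tau> * (power_sum N q x + 2 * \<i> * power_sum N (q - 1) x)"
  shows "integrable (Pi\<^sub>M {1..N} (\<lambda>_. lborel)) (\<lambda>x. (g x + f x * T x) * cauchy_weight N \<sigma> \<tau> x) \<and>
    (LINT x|Pi\<^sub>M {1..N} (\<lambda>_. lborel). (g x + f x * T x) * cauchy_weight N \<sigma> \<tau> x) = 0"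
  using assms(1,2)
proof induction
  case (monomial a d c)
  obtain p where q: "q = Suc (Suc p)" using assms(3) by (metis add_2_eq_Suc le_Suc_ex)
  define Df where "Df = (\<lambda>a x. of_nat (a + 2) * cauchy_factor \<sigma> \<tau> (a + 1) x
        + 2 * \<i> * of_nat (a + 1) * cauchy_factor \<sigma> \<tau> a x
        - \<sigma> * (2 * cauchy_factor \<sigma> \<tau> (a + 1) x + 2 * \<i> * cauchy_factor \<sigma> \<tau> a x)
        - \<i> * of_real \<tau> * (cauchy_factor \<sigma> \<tau> (a + 2) x + 2 * \<i> * cauchy_factor \<sigma> \<tau> (a + 1) x))"
  define Fj where "Fj = (\<lambda>j i. if i = j then Df (a j + p) else cauchy_factor \<sigma> \<tau> (a i))"
  define Tj where "Tj = (\<lambda>y::complex. of_nat q * y ^ (q - 1) + 2 * \<i> * of_nat (q - 1) * y ^ (q - 2)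
      - \<sigma> * (2 * y ^ (q - 1) + 2 * \<i> * y ^ (q - 2))
      - \<i> * of_real \<tau> * (y ^ q + 2 * \<i> * y ^ (q - 1)))"
  have T: "T x = (\<Sum>j=1..N. Tj (of_real (x j) - \<i>))" for x
    unfolding T_def Tj_def power_sum_def sum_distrib_left sum.distrib[symmetric]
      sum_subtractf[symmetric] by (rule refl)
  \<comment> \<open>The logarithmic field raises the exponent \<open>b\<close> to \<open>b + q - 1\<close> and \<open>b + q - 2\<close>; with \<open>p = q - 2\<close>
    this is the integrand of the one-variable lemma at exponent \<open>b + p\<close>.\<close>
  have one: "cauchy_factor \<sigma> \<tau> b r * (of_nat b * log_field q r + Tj (of_real r - \<i>)) = Df (b + p) r" for b r
  proof -
    define y where "y = complex_of_real r - \<i>"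
    define R where "R = exp (- \<i> * of_real \<tau> * complex_of_real r) * (1 / of_real (1 + r\<^sup>2) powr \<sigma>)"
    have cf: "cauchy_factor \<sigma> \<tau> m r = y ^ m * R" for m
      unfolding cauchy_factor_def y_def R_def by (rule refl)
    show ?thesis
      unfolding Df_def log_field_def Tj_def q cf y_def[symmetric]
      by (simp add: power_add algebra_simps)
  qed
  have step: "shifted_monomial N a x * cauchy_weight N \<sigma> \<tau> x *
      (of_nat (a j) * log_field q (x j) + Tj (of_real (x j) - \<i>)) = (\<Prod>i=1..N. Fj j i (x i))"
    if "j \<in> {1..N}" for j x
  proof -
    have "(\<Prod>i=1..N. Fj j i (x i)) = Df (a j + p) (x j) * (\<Prod>i\<in>{1..N} - {j}. cauchy_factor \<sigma> \<tau> (a i) (x i))"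
      using that by (simp add: prod.remove[of _ j] Fj_def)
    moreover have "shifted_monomial N a x * cauchy_weight N \<sigma> \<tau> x =
       cauchy_factor \<sigma> \<tau> (a j) (x j) * (\<Prod>i\<in>{1..N} - {j}. cauchy_factor \<sigma> \<tau> (a i) (x i))"
      unfolding shifted_monomial_times_weight using that by (simp add: prod.remove[of _ j])
    ultimately show ?thesis by (simp add: one[symmetric] mult_ac)
  qed
  have eq: "(c * shifted_monomial N a x * (\<Sum>j=1..N. of_nat (a j) * log_field q (x j))
        + c * shifted_monomial N a x * T x) * cauchy_weight N \<sigma> \<tau> x
      = c * (\<Sum>j=1..N. \<Prod>i=1..N. Fj j i (x i))" for x
  proof -
    have "(c * shifted_monomial N a x * (\<Sum>j=1..N. of_nat (a j) * log_field q (x j))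
        + c * shifted_monomial N a x * T x) * cauchy_weight N \<sigma> \<tau> x
      = c * (shifted_monomial N a x * cauchy_weight N \<sigma> \<tau> x *
          (\<Sum>j=1..N. of_nat (a j) * log_field q (x j) + Tj (of_real (x j) - \<i>)))"
      unfolding T sum.distrib by (simp add: algebra_simps)
    also have "\<dots> = c * (\<Sum>j=1..N. \<Prod>i=1..N. Fj j i (x i))"
      unfolding sum_distrib_left[of "shifted_monomial N a x * cauchy_weight N \<sigma> \<tau> x"]
      by (intro arg_cong[where f = "\<lambda>z. c * z"] sum.cong refl step)
    finally show ?thesis .
  qed
  have deg: "real (a i + q) - 2 * Re \<sigma> < -1" if "i \<in> {1..N}" for i
  proof -
    from monomial that have "a i \<le> d i" "real (d i + q) - 2 * Re \<sigma> < -1" by auto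
    then show ?thesis by simp
  qed
  have Dfint: "integrable lborel (Df (a i + p))" if "i \<in> {1..N}" for i
    unfolding Df_def using deg[OF that]
    by (intro Bochner_Integration.integrable_add Bochner_Integration.integrable_diff
        integrable_mult_right integrable_cauchy_factor) (auto simp: q)
  have Fint: "integrable lborel (Fj j i)" if "i \<in> {1..N}" for i j
    using deg[OF that] Dfint[OF that] by (auto simp: Fj_def intro!: integrable_cauchy_factor)
  have prod_int: "integrable (Pi\<^sub>M {1..N} (\<lambda>_. lborel)) (\<lambda>x. \<Prod>i=1..N. Fj j i (x i))" for j
    by (intro lborel_product.product_integrable_prod Fint) auto
  have zero: "(LINT x|Pi\<^sub>M {1..N} (\<lambda>_. lborel). (\<Prod>i=1..N. Fj j i (x i))) = 0" if j: "j \<in> {1..N}" for j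
  proof -
    have "integral\<^sup>L lborel (Fj j j) = 0"
      using integral_by_parts_cauchy_factor[of "a j + p" \<sigma> \<tau>] deg[OF j]
      by (simp add: Fj_def Df_def q)
    then have "(\<Prod>i=1..N. integral\<^sup>L lborel (Fj j i)) = 0"
      using j by (intro prod_zero) auto
    then show ?thesis
      by (subst lborel_product.product_integral_prod) (auto intro: Fint)
  qed
  show ?case
    unfolding eq using prod_int zero by simp
next
  case (add d f g f' g')
  have eq: "((g x + g' x) + (f x + f' x) * T x) * cauchy_weight N \<sigma> \<tau> x =
     (g x + f x * T x) * cauchy_weight N \<sigma> \<tau> x + (g' x + f' x * T x) * cauchy_weight N \<sigma> \<tau> x" for x
    by (simp add: algebra_simps)
  show ?case unfolding eq using add by simp
qed

section \<open>Fourier integrals as functions of the frequency\<close>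

lemma norm_exp_imaginary_diff_le:
  "norm (exp (- \<i> * of_real a * of_real r) - exp (- \<i> * of_real b * of_real r)) \<le> \<bar>a - b\<bar> * \<bar>r\<bar>"
proof -
  have "exp (- \<i> * of_real a * of_real r) - exp (- \<i> * of_real b * of_real r)
      = exp (- \<i> * of_real b * of_real r) * (exp (\<i> * of_real ((b - a) * r)) - 1)"
    by (simp add: right_diff_distrib exp_add[symmetric] algebra_simps)
  moreover have "norm (exp (- \<i> * complex_of_real b * of_real r)) = 1"
    by (simp add: norm_exp_eq_Re)
  ultimately have "norm (exp (- \<i> * of_real a * of_real r) - exp (- \<i> * of_real b * of_real r))
      = 2 * \<bar>sin ((b - a) * r / 2)\<bar>"
    by (simp add: norm_mult dist_exp_i_1[symmetric])
  also have "\<dots> \<le> 2 * \<bar>(b - a) * r / 2\<bar>"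
    by (intro mult_left_mono abs_sin_x_le_abs_x) auto
  finally show ?thesis by (simp add: abs_mult abs_minus_commute)
qed

lemma fourier_integral_continuous:
  fixes g :: "'a \<Rightarrow> complex" and \<theta> :: "'a \<Rightarrow> real"
  assumes g: "integrable M g" and [measurable]: "\<theta> \<in> borel_measurable M"
  shows "isCont (\<lambda>t. LINT x|M. exp (- \<i> * of_real t * of_real (\<theta> x)) * g x) t"
proof -
  have [measurable]: "g \<in> borel_measurable M" using g by auto
  have "(\<lambda>n. LINT x|M. exp (- \<i> * of_real (X n) * of_real (\<theta> x)) * g x)
      \<longlonglongrightarrow> (LINT x|M. exp (- \<i> * of_real t * of_real (\<theta> x)) * g x)"
    if X: "X \<longlonglongrightarrow> t" for X :: "nat \<Rightarrow> real"
  proof (rule integral_dominated_convergence)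
    show "integrable M (\<lambda>x. norm (g x))" using g by simp
    show "AE x in M. norm (exp (- \<i> * of_real (X n) * of_real (\<theta> x)) * g x) \<le> norm (g x)" for n
      by (simp add: norm_mult norm_exp_eq_Re)
    show "AE x in M. (\<lambda>n. exp (- \<i> * of_real (X n) * of_real (\<theta> x)) * g x)
        \<longlonglongrightarrow> exp (- \<i> * of_real t * of_real (\<theta> x)) * g x"
      using X by (intro AE_I2 tendsto_intros)
  qed measurable
  then show ?thesis
    unfolding isCont_def tendsto_at_iff_sequentially by (auto simp: comp_def)
qed

text \<open>Dominated convergence for the remainder \<open>R\<close> of the linear approximation of the character, which is
  bounded by \<open>2 \<bar>\<theta>\<bar>\<close> uniformly in the frequency.\<close>
lemma fourier_integral_has_vector_derivative:
  fixes g :: "'a \<Rightarrow> complex" and \<theta> :: "'a \<Rightarrow> real"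
  assumes g: "integrable M g" and tg: "integrable M (\<lambda>x. - \<i> * of_real (\<theta> x) * g x)"
    and [measurable]: "\<theta> \<in> borel_measurable M"
  shows "((\<lambda>t. LINT x|M. exp (- \<i> * of_real t * of_real (\<theta> x)) * g x) has_vector_derivative
     (LINT x|M. exp (- \<i> * of_real t * of_real (\<theta> x)) * (- \<i> * of_real (\<theta> x) * g x))) (at t)"
proof -
  have [measurable]: "g \<in> borel_measurable M" using g by auto
  define e where "e = (\<lambda>t x. exp (- \<i> * of_real t * of_real (\<theta> x)))"
  have e1: "norm (e t x) = 1" for t x by (simp add: e_def norm_exp_eq_Re)
  have [measurable]: "e t \<in> borel_measurable M" for t by (simp add: e_def)
  have ie: "integrable M (\<lambda>x. e t x * h x)" if "integrable M h" for h t
  proof (rule Bochner_Integration.integrable_bound[OF that])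
    have [measurable]: "h \<in> borel_measurable M" using that by auto
    show "(\<lambda>x. e t x * h x) \<in> borel_measurable M" by measurable
  qed (simp add: norm_mult e1)
  define D where "D = (LINT x|M. e t x * (- \<i> * of_real (\<theta> x) * g x))"
  define R where "R = (\<lambda>y x. (e y x - e t x - of_real (y - t) * (- \<i> * of_real (\<theta> x)
      * e t x)) / of_real \<bar>y - t\<bar>)"
  have R_int: "((LINT x|M. e y x * g x) - (LINT x|M. e t x * g x) - (y - t) *\<^sub>R D) / of_real \<bar>y - t\<bar>
      = (LINT x|M. R y x * g x)" for y
  proof -
    have "(LINT x|M. R y x * g x) = (LINT x|M. ((e y x * g x) - e t x * g x - of_real (y - t) * (e t x
        * (- \<i> * of_real (\<theta> x) * g x))) / of_real \<bar>y - t\<bar>)"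
      by (intro Bochner_Integration.integral_cong refl)
          (simp add: R_def algebra_simps diff_divide_distrib add_divide_distrib)
    also have "\<dots> = ((LINT x|M. e y x * g x) - (LINT x|M. e t x * g x) - of_real (y - t) * D) / of_real \<bar>y - t\<bar>"
      unfolding D_def
      by (subst integral_divide_zero, subst Bochner_Integration.integral_diff)
        (use ie g tg in \<open>simp_all add: Bochner_Integration.integral_diff\<close>)
    finally show ?thesis by (simp add: scaleR_conv_of_real)
  qed
  have lim: "((\<lambda>y. R y x) \<longlongrightarrow> 0) (at t)" for x
  proof -
    have "((\<lambda>y. - \<i> * complex_of_real y * of_real (\<theta> x)) has_vector_derivative - \<i> * of_real (\<theta> x)) (at t)"
      by (auto intro!: derivative_eq_intros)
    from field_vector_diff_chain_at[OF this DERIV_exp]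
    have "((\<lambda>y. e y x) has_vector_derivative - \<i> * of_real (\<theta> x) * e t x) (at t)"
      by (simp add: o_def e_def)
    then have "((\<lambda>y. norm (R y x)) \<longlongrightarrow> 0) (at t)"
      unfolding has_vector_derivative_def has_derivative_iff_norm
      by (simp add: R_def norm_divide scaleR_conv_of_real)
    then show ?thesis by (rule tendsto_norm_zero_cancel)
  qed
  have bound: "norm (R y x) \<le> 2 * \<bar>\<theta> x\<bar>" for y x
  proof (cases "y = t")
    case False
    have "norm (e y x - e t x - of_real (y - t) * (- \<i> * of_real (\<theta> x) * e t x))
        \<le> norm (e y x - e t x) + norm (of_real (y - t) * (- \<i> * of_real (\<theta> x) * e t x))"
      by (rule norm_triangle_ineq4)
    also have "\<dots> \<le> \<bar>y - t\<bar> * \<bar>\<theta> x\<bar> + \<bar>y - t\<bar> * \<bar>\<theta> x\<bar>"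
    proof (rule add_mono)
      show "norm (e y x - e t x) \<le> \<bar>y - t\<bar> * \<bar>\<theta> x\<bar>"
        unfolding e_def by (rule norm_exp_imaginary_diff_le)
    qed (simp add: norm_mult e1 del: of_real_diff)
    finally show ?thesis using False by (simp add: R_def norm_divide field_simps del: of_real_diff)
  qed (simp add: R_def)
  have [measurable]: "R y \<in> borel_measurable M" for y unfolding R_def by measurable
  have "((\<lambda>y. LINT x|M. R y x * g x) \<longlongrightarrow> 0) (at t)"
    unfolding tendsto_at_iff_sequentially
  proof (intro allI impI)
    fix X :: "nat \<Rightarrow> real" assume X: "\<forall>i. X i \<in> UNIV - {t}" "X \<longlonglongrightarrow> t"
    have "(\<lambda>n. LINT x|M. R (X n) x * g x) \<longlonglongrightarrow> (LINT x|M. 0)"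
    proof (rule integral_dominated_convergence)
      show "integrable M (\<lambda>x. 2 * norm (- \<i> * of_real (\<theta> x) * g x))" using tg by simp
      show "AE x in M. norm (R (X n) x * g x) \<le> 2 * norm (- \<i> * of_real (\<theta> x) * g x)" for n
        using bound[of "X n"] by (auto simp: norm_mult mult.assoc[symmetric] intro!: mult_right_mono)
      show "AE x in M. (\<lambda>n. R (X n) x * g x) \<longlonglongrightarrow> 0"
      proof (rule AE_I2)
        fix x
        have "(\<lambda>n. R (X n) x) \<longlonglongrightarrow> 0"
          using lim[of x] X unfolding tendsto_at_iff_sequentially by (auto simp: comp_def)
        then show "(\<lambda>n. R (X n) x * g x) \<longlonglongrightarrow> 0" by (rule tendsto_mult_left_zero)
      qed
    qed measurable
    then show "((\<lambda>y. LINT x|M. R y x * g x) \<circ> X) \<longlonglongrightarrow> 0" by (simp add: comp_def)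
  qed
  then have "((\<lambda>t. LINT x|M. e t x * g x) has_vector_derivative D) (at t)"
    unfolding has_vector_derivative_def has_derivative_iff_norm R_int[symmetric]
    by (auto simp: norm_divide intro!: bounded_linear_scaleR_left dest: tendsto_norm_zero)
  then show ?thesis by (simp only: e_def D_def)
qed

section \<open>Observables and their moments\<close>

definition norm_power_sum :: "nat \<Rightarrow> nat \<Rightarrow> (nat \<Rightarrow> real) \<Rightarrow> complex" where
  "norm_power_sum N r x = power_sum N r x / of_nat N"

definition observable :: "nat \<Rightarrow> nat multiset \<Rightarrow> (nat \<Rightarrow> real) \<Rightarrow> complex" where
  "observable N \<mu> x = (\<Prod>r\<in>#\<mu>. norm_power_sum N r x)"

lemma observable_add_mset [simp]: "observable N (add_mset r \<mu>) x = norm_power_sum N r x * observable N \<mu> x"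
  by (simp add: observable_def)

lemma observable_empty [simp]: "observable N {#} x = 1"
  by (simp add: observable_def)

lemma norm_power_sum_0: "N \<ge> 1 \<Longrightarrow> norm_power_sum N 0 x = 1"
  by (simp add: norm_power_sum_def power_sum_def)

text \<open>The character and the ensemble weight combine into the squared Vandermonde determinant times a
  function with independent variables.\<close>
lemma exp_trace_times_weight:
  "exp_trace N t x * hua_pickrell_weight s N x
     = vandermonde_square N x * cauchy_weight N (s + of_nat N) (t / real N) x"
proof -
  have "exp_trace N t x = exp (\<Sum>j=1..N. - \<i> * of_real (t / real N) * of_real (x j))"
    by (simp add: exp_trace_def sum_distrib_left)
  also have "\<dots> = (\<Prod>j=1..N. exp (- \<i> * of_real (t / real N) * of_real (x j)))"
    by (rule exp_sum) simp
  finally show ?thesis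
    unfolding hua_pickrell_weight_def vandermonde_square_def cauchy_weight_def prod.distrib
    by (simp only: mult_ac)
qed

lemma flow_poly_norm_power_sum:
  assumes "q \<ge> 2"
  shows "flow_poly N q (\<lambda>_. r) (norm_power_sum N r)
    (\<lambda>x. of_nat r * (norm_power_sum N (r + q - 1) x + 2 * \<i> * norm_power_sum N (r + q - 2) x))"
proof -
  have "flow_poly N q (\<lambda>_. r) (\<lambda>x. 1 / of_nat N * (\<Sum>j=1..N. (of_real (x j) - \<i>) ^ r))
    (\<lambda>x. 1 / of_nat N * (\<Sum>j=1..N. of_nat r * ((of_real (x j) - \<i>) ^ (r + q - 1) + 2 * \<i>
        * (of_real (x j) - \<i>) ^ (r + q - 2))))"
  proof (intro flow_poly_cmult flow_poly_sum)
    fix j assume "j \<in> {1..N}"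
    from flow_poly_power_coord[OF this assms, of r]
    show "flow_poly N q (\<lambda>_. r) (\<lambda>x. (of_real (x j) - \<i>) ^ r)
      (\<lambda>x. of_nat r * ((of_real (x j) - \<i>) ^ (r + q - 1) + 2 * \<i> * (of_real (x j) - \<i>) ^ (r + q - 2)))"
      by (rule flow_poly_cong_degree) simp
  qed
  moreover have "norm_power_sum N r = (\<lambda>x. 1 / of_nat N * (\<Sum>j=1..N. (of_real (x j) - \<i>) ^ r))"
    by (simp add: norm_power_sum_def power_sum_def fun_eq_iff)
  moreover have "of_nat r * (norm_power_sum N (r + q - 1) x + 2 * \<i> * norm_power_sum N (r + q - 2) x)
     = 1 / of_nat N * (\<Sum>j=1..N. of_nat r * ((of_real (x j) - \<i>) ^ (r + q - 1) + 2 * \<i>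
         * (of_real (x j) - \<i>) ^ (r + q - 2)))" for x
    unfolding norm_power_sum_def power_sum_def sum.distrib sum_distrib_left[symmetric]
    by (simp add: ring_distribs add_divide_distrib)
  ultimately show ?thesis by simp
qed

text \<open>The effect of the derivation along \<open>V\<close> on the factor \<open>u\<^sub>r\<close>: its exponent grows by \<open>q - 1\<close> or
  by \<open>q - 2\<close>, which merges it with that of the field.\<close>
definition merged_observable :: "nat \<Rightarrow> nat \<Rightarrow> nat multiset \<Rightarrow> nat \<Rightarrow> (nat \<Rightarrow> real) \<Rightarrow> complex" where
  "merged_observable N q \<mu> r x = of_nat r *
     (observable N (add_mset (r + q - 1) (\<mu> - {#r#})) x
      + 2 * \<i> * observable N (add_mset (r + q - 2) (\<mu> - {#r#})) x)"

lemma flow_poly_observable: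
  assumes "q \<ge> 2"
  shows "flow_poly N q (\<lambda>_. sum_mset \<mu>) (observable N \<mu>) (\<lambda>x. \<Sum>r\<in>#\<mu>. merged_observable N q \<mu> r x)"
proof (induction \<mu>)
  case empty
  show ?case using flow_poly_const[of N q "\<lambda>_. 0" 1] by (simp add: observable_def[abs_def])
next
  case (add r \<mu>)
  have fn: "observable N (add_mset r \<mu>) = (\<lambda>x. norm_power_sum N r x * observable N \<mu> x)"
    by (simp add: fun_eq_iff)
  \<comment> \<open>Removing an element of \<open>\<mu>\<close> commutes with adding \<open>r\<close>, so the sum over the old factors is unchanged.\<close>
  have one: "merged_observable N q (add_mset r \<mu>) c x = norm_power_sum N r x * merged_observable N q \<mu> c x"
    if "c \<in># \<mu>" for c x
    using that by (simp add: merged_observable_def algebra_simps)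
  have sum: "(\<Sum>c\<in>#\<mu>. merged_observable N q (add_mset r \<mu>) c x)
      = norm_power_sum N r x * (\<Sum>c\<in>#\<mu>. merged_observable N q \<mu> c x)" for x
    unfolding sum_mset_distrib_left
    by (intro arg_cong[where f = sum_mset] image_mset_cong one)
  have der: "(\<Sum>c\<in>#add_mset r \<mu>. merged_observable N q (add_mset r \<mu>) c x) =
     of_nat r * (norm_power_sum N (r + q - 1) x + 2 * \<i> * norm_power_sum N (r + q - 2) x) * observable N \<mu> x
     + norm_power_sum N r x * (\<Sum>c\<in>#\<mu>. merged_observable N q \<mu> c x)" for x
    by (simp add: sum) (simp add: merged_observable_def algebra_simps)
  have deg: "(\<lambda>_::nat. sum_mset (add_mset r \<mu>)) = (\<lambda>_. r + sum_mset \<mu>)" by simp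
  show ?case
    unfolding fn der deg by (rule flow_poly_mult[OF add flow_poly_norm_power_sum[OF assms]])
qed

text \<open>Integrability is part of this relation because the integral is linear only on integrable
  functions; with it, the expansion of a loop equation into moments becomes a matter of applying
  introduction rules.\<close>
definition has_expectation :: "complex \<Rightarrow> nat \<Rightarrow> real \<Rightarrow> ((nat \<Rightarrow> real) \<Rightarrow> complex) \<Rightarrow> complex \<Rightarrow> bool" where
  "has_expectation s N t f v \<longleftrightarrow>
     hua_pickrell_integrable s N (\<lambda>x. exp_trace N t x * f x) \<and>
     hua_pickrell_E s N (\<lambda>x. exp_trace N t x * f x) = v"

lemma has_expectation_cong:
  assumes "has_expectation s N t f v" "\<And>x. f x = g x" "v = w"
  shows "has_expectation s N t g w"
  using assms by (simp add: has_expectation_def)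

lemma has_expectation_unique:
  "has_expectation s N t f v \<Longrightarrow> has_expectation s N t f w \<Longrightarrow> v = w"
  by (simp add: has_expectation_def)

lemma has_expectation_add:
  assumes "has_expectation s N t f v" "has_expectation s N t g w"
  shows "has_expectation s N t (\<lambda>x. f x + g x) (v + w)"
  using assms
  by (auto simp: has_expectation_def hua_pickrell_integrable_def hua_pickrell_E_def distrib_left distrib_right)

lemma has_expectation_cmult:
  assumes "has_expectation s N t f v"
  shows "has_expectation s N t (\<lambda>x. c * f x) (c * v)"
proof -
  have eq: "exp_trace N t x * (c * f x) * hua_pickrell_weight s N x
     = c * (exp_trace N t x * f x * hua_pickrell_weight s N x)" for x
    by (simp add: mult_ac)
  show ?thesis
    using assms unfolding has_expectation_def hua_pickrell_integrable_def hua_pickrell_E_def eq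
    by (auto simp: mult_ac)
qed

lemma has_expectation_0: "has_expectation s N t (\<lambda>x. 0) 0"
  by (simp add: has_expectation_def hua_pickrell_integrable_def hua_pickrell_E_def)

lemma has_expectation_diff:
  assumes "has_expectation s N t f v" "has_expectation s N t g w"
  shows "has_expectation s N t (\<lambda>x. f x - g x) (v - w)"
  using has_expectation_add[OF assms(1) has_expectation_cmult[OF assms(2), of "-1"]] by simp

lemma has_expectation_sum:
  assumes "\<And>i. i \<in> A \<Longrightarrow> has_expectation s N t (f i) (v i)"
  shows "has_expectation s N t (\<lambda>x. \<Sum>i\<in>A. f i x) (\<Sum>i\<in>A. v i)"
  using assms
  by (induction A rule: infinite_finite_induct) (auto intro: has_expectation_0 has_expectation_add)

lemma has_expectation_sum_mset:
  assumes "\<And>i. i \<in># A \<Longrightarrow> has_expectation s N t (f i) (v i)"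
  shows "has_expectation s N t (\<lambda>x. \<Sum>i\<in>#A. f i x) (\<Sum>i\<in>#A. v i)"
  using assms by (induction A) (auto intro: has_expectation_0 has_expectation_add)

definition moment :: "complex \<Rightarrow> nat \<Rightarrow> real \<Rightarrow> nat multiset \<Rightarrow> complex" where
  "moment s N t \<mu> = hua_pickrell_E s N (\<lambda>x. exp_trace N t x * observable N \<mu> x)"

text \<open>The count behind the half-plane of the theorem: with the Vandermonde factor, the degree in each variable is at most
  \<open>K + 2(N - 1)\<close>, and it has to stay below \<open>2 Re (s + N) - 1\<close>.\<close>
lemma flow_poly_hua_pickrell_integrable:
  assumes "N \<ge> 1" "Re s > (real K - 1) / 2" "flow_poly N 2 (\<lambda>_. m) f g" "m \<le> K"
  shows "hua_pickrell_integrable s N (\<lambda>x. exp_trace N t x * f x)"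
proof -
  have "flow_poly N 2 (\<lambda>i. m + 2 * (N - 1)) (\<lambda>x. f x * vandermonde_square N x) 
     (\<lambda>x. g x * vandermonde_square N x + f x * (vandermonde_square N x *
      ((\<Sum>a<2. power_sum N a x * power_sum N (2 - Suc a) x) - of_nat 2 * power_sum N (2 - 1) x
       + 2 * \<i> * ((\<Sum>a<2-1. power_sum N a x * power_sum N (2 - 1 - Suc a) x)
            - of_nat (2 - 1) * power_sum N (2 - 2) x))))"
    by (rule flow_poly_mult[OF flow_poly_vandermonde assms(3)]) simp
  then have "integrable (Pi\<^sub>M {1..N} (\<lambda>_. lborel))
      (\<lambda>x. f x * vandermonde_square N x * cauchy_weight N (s + of_nat N) (t / real N) x)"
  proof (rule flow_poly_integrable)
    have "real (m + 2 * (N - 1)) \<le> real K + 2 * real N - 2" using assms(1,4) by linarith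
    then show "real (m + 2 * (N - 1)) - 2 * Re (s + of_nat N) < - 1"
      using assms(2) by (simp add: field_simps)
  qed
  moreover have "f x * vandermonde_square N x * cauchy_weight N (s + of_nat N) (t / real N) x
     = exp_trace N t x * f x * hua_pickrell_weight s N x" for x
    using exp_trace_times_weight[of N t x s] by (simp add: mult_ac)
  ultimately show ?thesis by (simp add: hua_pickrell_integrable_def)
qed

lemma has_expectation_observable:
  assumes "N \<ge> 1" "Re s > (real K - 1) / 2" "sum_mset \<mu> \<le> K"
  shows "has_expectation s N t (observable N \<mu>) (moment s N t \<mu>)"
  using flow_poly_hua_pickrell_integrable[OF assms(1,2) flow_poly_observable assms(3)]
  by (simp add: has_expectation_def moment_def)

lemma moment_add_mset_0: "N \<ge> 1 \<Longrightarrow> moment s N t (add_mset 0 \<mu>) = moment s N t \<mu>"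
  by (simp add: moment_def norm_power_sum_0)

section \<open>The loop equation\<close>

text \<open>The vanishing integral of the divergence of \<open>V u\<^sub>\<mu>\<close> against the density, sorted by origin: the two
  sums over \<open>a\<close> come from the Vandermonde factor, the terms with \<open>s + N\<close> from the Cauchy weight, the sum over
  \<open>\<mu>\<close> from differentiating \<open>u\<^sub>\<mu>\<close>, and the left-hand side from the character.\<close>
lemma loop_equation:
  assumes N: "N \<ge> 1" and s: "Re s > (real K - 1) / 2" and q: "q \<ge> 2" and K: "q + sum_mset \<mu> \<le> K"
  shows "\<i> * of_real t * (moment s N t (add_mset q \<mu>) + 2 * \<i> * moment s N t (add_mset (q - 1) \<mu>)) =
     (of_nat N)\<^sup>2 * ((\<Sum>a<q. moment s N t (add_mset a (add_mset (q - Suc a) \<mu>)))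
        + 2 * \<i> * (\<Sum>a<q-1. moment s N t (add_mset a (add_mset (q - 1 - Suc a) \<mu>))))
     - 2 * (s + of_nat N) * of_nat N * (moment s N t (add_mset (q - 1) \<mu>) + \<i>
         * moment s N t (add_mset (q - 2) \<mu>))
     + (\<Sum>r\<in>#\<mu>. of_nat r * (moment s N t (add_mset (r + q - 1) (\<mu> - {#r#}))
          + 2 * \<i> * moment s N t (add_mset (r + q - 2) (\<mu> - {#r#}))))"
proof -
  define X where "X = (\<lambda>x. (\<Sum>r\<in>#\<mu>. merged_observable N q \<mu> r x)
     + (of_nat N)\<^sup>2 * ((\<Sum>a<q. observable N (add_mset a (add_mset (q - Suc a) \<mu>)) x)
        + 2 * \<i> * (\<Sum>a<q-1. observable N (add_mset a (add_mset (q - 1 - Suc a) \<mu>)) x))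
     - 2 * (s + of_nat N) * of_nat N * (observable N (add_mset (q - 1) \<mu>) x + \<i>
         * observable N (add_mset (q - 2) \<mu>) x)
     - \<i> * of_real t * (observable N (add_mset q \<mu>) x + 2 * \<i> * observable N (add_mset (q - 1) \<mu>) x))"
  define V where "V = (\<Sum>r\<in>#\<mu>. of_nat r * (moment s N t (add_mset (r + q - 1) (\<mu> - {#r#}))
          + 2 * \<i> * moment s N t (add_mset (r + q - 2) (\<mu> - {#r#}))))
     + (of_nat N)\<^sup>2 * ((\<Sum>a<q. moment s N t (add_mset a (add_mset (q - Suc a) \<mu>)))
        + 2 * \<i> * (\<Sum>a<q-1. moment s N t (add_mset a (add_mset (q - 1 - Suc a) \<mu>))))
     - 2 * (s + of_nat N) * of_nat N * (moment s N t (add_mset (q - 1) \<mu>) + \<i>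
         * moment s N t (add_mset (q - 2) \<mu>))
     - \<i> * of_real t * (moment s N t (add_mset q \<mu>) + 2 * \<i> * moment s N t (add_mset (q - 1) \<mu>))"
  note obs = has_expectation_observable[OF N s]
  have merged: "has_expectation s N t (merged_observable N q \<mu> r)
      (of_nat r * (moment s N t (add_mset (r + q - 1) (\<mu> - {#r#}))
          + 2 * \<i> * moment s N t (add_mset (r + q - 2) (\<mu> - {#r#}))))" if "r \<in># \<mu>" for r
  proof -
    have "sum_mset \<mu> = r + sum_mset (\<mu> - {#r#})" using that by (metis sum_mset.remove)
    then show ?thesis
      unfolding merged_observable_def using K q
      by (intro has_expectation_cmult has_expectation_add obs) auto
  qed
  have 1: "has_expectation s N t X V"
    unfolding X_def V_def using K q
    by (intro has_expectation_add has_expectation_diff has_expectation_cmult has_expectation_sum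
        has_expectation_sum_mset merged obs) auto
  let ?T = "\<lambda>x. of_nat q * power_sum N (q - 1) x + 2 * \<i> * of_nat (q - 1) * power_sum N (q - 2) x
      - (s + of_nat N) * (2 * power_sum N (q - 1) x + 2 * \<i> * power_sum N (q - 2) x)
      - \<i> * of_real (t / real N) * (power_sum N q x + 2 * \<i> * power_sum N (q - 1) x)"
  let ?g = "\<lambda>x. (\<Sum>r\<in>#\<mu>. merged_observable N q \<mu> r x) * vandermonde_square N x
     + observable N \<mu> x * (vandermonde_square N x *
      ((\<Sum>a<q. power_sum N a x * power_sum N (q - Suc a) x) - of_nat q * power_sum N (q - 1) x
       + 2 * \<i> * ((\<Sum>a<q-1. power_sum N a x * power_sum N (q - 1 - Suc a) x)
            - of_nat (q - 1) * power_sum N (q - 2) x)))"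
  \<comment> \<open>The diagonal terms of the Vandermonde factor cancel the divergence of \<open>V\<close>, and since \<open>\<tau> = t / N\<close>
    all remaining terms combine normalised power sums with the stated powers of \<open>N\<close>.\<close>
  have pw: "(?g x + observable N \<mu> x * vandermonde_square N x * ?T x) * cauchy_weight N (s
      + of_nat N) (t / real N) x
      = exp_trace N t x * X x * hua_pickrell_weight s N x" for x
  proof -
    have p: "power_sum N r x = of_nat N * norm_power_sum N r x" for r
      using N by (simp add: norm_power_sum_def)
    have tN: "complex_of_real (t / real N) = of_real t / of_nat N" by simp
    define A where "A = (\<Sum>a<q. norm_power_sum N a x * norm_power_sum N (q - Suc a) x)"
    define B where "B = (\<Sum>a<q-1. norm_power_sum N a x * norm_power_sum N (q - 1 - Suc a) x)"
    have A: "(\<Sum>a<q. power_sum N a x * power_sum N (q - Suc a) x) = (of_nat N)\<^sup>2 * A"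
      unfolding p A_def sum_distrib_left by (simp add: power2_eq_square mult_ac)
    have B: "(\<Sum>a<q-1. power_sum N a x * power_sum N (q - 1 - Suc a) x) = (of_nat N)\<^sup>2 * B"
      unfolding p B_def sum_distrib_left by (simp add: power2_eq_square mult_ac)
    have A': "(\<Sum>a<q. observable N (add_mset a (add_mset (q - Suc a) \<mu>)) x) = A * observable N \<mu> x"
      unfolding A_def sum_distrib_right by (simp add: mult_ac)
    have B': "(\<Sum>a<q-1. observable N (add_mset a (add_mset (q - 1 - Suc a) \<mu>)) x) = B * observable N \<mu> x"
      unfolding B_def sum_distrib_right by (simp add: mult_ac)
    have t': "\<i> * (complex_of_real t / of_nat N) * (of_nat N * norm_power_sum N q x + 2 * \<i> * (of_nat N
        * norm_power_sum N (q - 1) x))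
      = \<i> * of_real t * (norm_power_sum N q x + 2 * \<i> * norm_power_sum N (q - 1) x)"
      using N by (simp add: field_simps)
    have "?g x + observable N \<mu> x * vandermonde_square N x * ?T x = X x * vandermonde_square N x"
      unfolding A B X_def A' B' unfolding p tN t' observable_add_mset
      by (simp add: ring_distribs mult_ac)
    then show ?thesis using exp_trace_times_weight[of N t x s] by (simp add: mult_ac)
  qed
  have 2: "has_expectation s N t X 0"
  proof -
    have "integrable (Pi\<^sub>M {1..N} (\<lambda>_. lborel)) (\<lambda>x. (?g x + observable N \<mu> x * vandermonde_square N x * ?T x)
           * cauchy_weight N (s + of_nat N) (t / real N) x) \<and>
      (LINT x|Pi\<^sub>M {1..N} (\<lambda>_. lborel). (?g x + observable N \<mu> x * vandermonde_square N x * ?T x)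
           * cauchy_weight N (s + of_nat N) (t / real N) x) = 0"
    proof (rule flow_poly_integral_by_parts[OF flow_poly_mult[OF flow_poly_vandermonde[OF q] flow_poly_observable[OF q]] _ q])
      have "real (sum_mset \<mu> + 2 * (N - 1) + q) \<le> real K + 2 * real N - 2" using N K by linarith
      then show "real (sum_mset \<mu> + 2 * (N - 1) + q) - 2 * Re (s + of_nat N) < - 1"
        using s by (simp add: field_simps)
    qed
    then show ?thesis
      unfolding pw by (simp add: has_expectation_def hua_pickrell_integrable_def hua_pickrell_E_def)
  qed
  have "V = 0" using has_expectation_unique[OF 1 2] .
  then show ?thesis unfolding V_def by (simp add: algebra_simps)
qed

section \<open>Derivatives of the characteristic function\<close>

text \<open>The logarithmic derivative of the character in \<open>t\<close>; the \<open>m\<close>-th derivative of an expectation inserts its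
  \<open>m\<close>-th power.\<close>
definition trace_velocity :: "nat \<Rightarrow> (nat \<Rightarrow> real) \<Rightarrow> complex" where
  "trace_velocity N x = - \<i> * of_real ((\<Sum>j=1..N. x j) / real N)"

lemma norm_power_sum_1:
  assumes "N \<ge> 1"
  shows "norm_power_sum N 1 x = \<i> * (trace_velocity N x - 1)"
proof -
  have "norm_power_sum N 1 x = of_real ((\<Sum>j=1..N. x j) / real N) - \<i>"
    using assms by (simp add: norm_power_sum_def power_sum_def sum_subtractf diff_divide_distrib)
  moreover have "z - \<i> = \<i> * (- \<i> * z - 1)" for z
    by (simp add: right_diff_distrib)
  ultimately show ?thesis
    unfolding trace_velocity_def by simp
qed

lemma flow_poly_trace_velocity_power:
  assumes "N \<ge> 1"
  shows "\<exists>g. flow_poly N 2 (\<lambda>_. m) (\<lambda>x. trace_velocity N x ^ m) g"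
proof (induction m)
  case 0
  show ?case using flow_poly_const[of N 2 "\<lambda>_. 0" 1] by auto
next
  case (Suc m)
  then obtain g where g: "flow_poly N 2 (\<lambda>_. m) (\<lambda>x. trace_velocity N x ^ m) g" by blast
  have "- \<i> * (\<i> * (z - 1)) + 1 = z" for z
    by (simp add: right_diff_distrib)
  then have "trace_velocity N = (\<lambda>x. - \<i> * norm_power_sum N 1 x + 1)"
    unfolding norm_power_sum_1[OF assms] by (simp only:)
  moreover have "\<exists>g. flow_poly N 2 (\<lambda>_. 1) (\<lambda>x. - \<i> * norm_power_sum N 1 x + 1) g"
    by (rule exI, rule flow_poly.add[OF flow_poly_cmult[OF flow_poly_norm_power_sum] flow_poly_const]) simp
  ultimately obtain h where h: "flow_poly N 2 (\<lambda>_. 1) (trace_velocity N) h" by auto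
  from flow_poly_mult[OF g h] show ?case by auto
qed

lemma trace_velocity_power_integrable:
  assumes "N \<ge> 1" "Re s > (real K - 1) / 2" "m \<le> K"
  shows "hua_pickrell_integrable s N (\<lambda>x. exp_trace N t x * trace_velocity N x ^ m)"
proof -
  obtain g where "flow_poly N 2 (\<lambda>_. m) (\<lambda>x. trace_velocity N x ^ m) g"
    using flow_poly_trace_velocity_power[OF assms(1)] by blast
  from flow_poly_hua_pickrell_integrable[OF assms(1,2) this assms(3)] show ?thesis .
qed

lemma exp_trace_alt: "exp_trace N t x = exp (- \<i> * of_real t * of_real ((\<Sum>j=1..N. x j) / real N))"
  by (simp add: exp_trace_def sum_divide_distrib)

lemma exp_trace_0: "exp_trace N 0 x = 1"
  by (simp add: exp_trace_def)

lemma measurable_trace [measurable]: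
  "(\<lambda>x. (\<Sum>j=1..N. x j) / real N) \<in> borel_measurable (Pi\<^sub>M {1..N} (\<lambda>_. lborel))"
  by (intro borel_measurable_divide borel_measurable_sum) (auto intro!: measurable_component_singleton)

lemma vector_derivative_expectation:
  assumes "N \<ge> 1" "Re s > (real K - 1) / 2" "Suc m \<le> K"
  shows "((\<lambda>t. hua_pickrell_E s N (\<lambda>x. exp_trace N t x * trace_velocity N x ^ m)) has_vector_derivative
     hua_pickrell_E s N (\<lambda>x. exp_trace N t x * trace_velocity N x ^ Suc m)) (at t)"
proof -
  let ?M = "Pi\<^sub>M {1..N} (\<lambda>_. lborel) :: (nat \<Rightarrow> real) measure"
  let ?\<theta> = "\<lambda>x. (\<Sum>j=1..N. x j) / real N"
  define g where "g = (\<lambda>x. trace_velocity N x ^ m * hua_pickrell_weight s N x)"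
  have tv: "- \<i> * of_real (?\<theta> x) * g x = trace_velocity N x ^ Suc m * hua_pickrell_weight s N x" for x
    by (simp add: g_def trace_velocity_def)
  have "integrable ?M g"
    using trace_velocity_power_integrable[OF assms(1,2), of m 0] assms(3)
    by (simp add: hua_pickrell_integrable_def g_def exp_trace_0)
  moreover have "integrable ?M (\<lambda>x. - \<i> * of_real (?\<theta> x) * g x)"
    unfolding tv using trace_velocity_power_integrable[OF assms(1,2,3), of 0]
    by (simp add: hua_pickrell_integrable_def exp_trace_0)
  ultimately have "((\<lambda>t. LINT x|?M. exp (- \<i> * of_real t * of_real (?\<theta> x)) * g x) has_vector_derivative
     (LINT x|?M. exp (- \<i> * of_real t * of_real (?\<theta> x)) * (- \<i> * of_real (?\<theta> x) * g x))) (at t)"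
    by (intro fourier_integral_has_vector_derivative measurable_trace)
  then have "((\<lambda>t. LINT x|?M. exp_trace N t x * g x) has_vector_derivative
     (LINT x|?M. exp_trace N t x * (trace_velocity N x ^ Suc m * hua_pickrell_weight s N x))) (at t)"
    unfolding tv exp_trace_alt[symmetric] .
  then show ?thesis
    unfolding hua_pickrell_E_def g_def mult.assoc
    by (intro has_vector_derivative_mult_right)
qed

lemma nth_vector_derivative_expectation:
  assumes "N \<ge> 1" "Re s > (real K - 1) / 2" "m \<le> K"
  shows "nth_vector_derivative m (\<lambda>t. hua_pickrell_E s N (exp_trace N t))
     = (\<lambda>t. hua_pickrell_E s N (\<lambda>x. exp_trace N t x * trace_velocity N x ^ m))"
  using assms(3)
proof (induction m)
  case 0
  show ?case by (simp add: nth_vector_derivative_def)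
next
  case (Suc m)
  then have "nth_vector_derivative (Suc m) (\<lambda>t. hua_pickrell_E s N (exp_trace N t))
    = (\<lambda>t. vector_derivative (\<lambda>t. hua_pickrell_E s N (\<lambda>x. exp_trace N t x * trace_velocity N x ^ m)) (at t))"
    by (simp add: nth_vector_derivative_def)
  then show ?case
    using vector_derivative_at[OF vector_derivative_expectation[OF assms(1,2) Suc.prems]] by simp
qed

lemma continuous_expectation:
  assumes "hua_pickrell_integrable s N f"
  shows "isCont (\<lambda>t. hua_pickrell_E s N (\<lambda>x. exp_trace N t x * f x)) t"
proof -
  let ?M = "Pi\<^sub>M {1..N} (\<lambda>_. lborel) :: (nat \<Rightarrow> real) measure"
  have "isCont (\<lambda>t. LINT x|?M. exp_trace N t x * (f x * hua_pickrell_weight s N x)) t"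
    unfolding exp_trace_alt using assms
    by (intro fourier_integral_continuous measurable_trace) (simp add: hua_pickrell_integrable_def)
  then show ?thesis
    unfolding hua_pickrell_E_def mult.assoc by (intro continuous_intros)
qed

text \<open>The base of the reduction: here the observable is \<open>u\<^sub>1\<^sup>m = \<i>\<^sup>m (\<theta> - 1)\<^sup>m\<close>, and the binomial theorem
  expresses it through powers of \<open>\<theta>\<close>, that is, through derivatives.\<close>
lemma moment_ones:
  assumes N: "N \<ge> 1" and s: "Re s > (real K - 1) / 2" and le: "\<And>r. r \<in># \<mu> \<Longrightarrow> r \<le> 1"
    and m: "m = sum_mset \<mu>" "m \<le> K"
  shows "moment s N t \<mu> = (\<Sum>j\<le>m. \<i> ^ m * (of_nat (m choose j) * (- 1) ^ (m - j))
     * nth_vector_derivative j (\<lambda>t. hua_pickrell_E s N (exp_trace N t)) t)"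
proof -
  have "observable N \<mu> x = norm_power_sum N 1 x ^ sum_mset \<mu>" for x
    using le
  proof (induction \<mu>)
    case (add r \<mu>)
    then have "r \<le> 1" by auto
    then consider "r = 0" | "r = 1" by linarith
    then show ?case using add by cases (auto simp: norm_power_sum_0[OF N])
  qed simp
  then have obs: "observable N \<mu> x = (\<Sum>j\<le>m. \<i> ^ m * (of_nat (m choose j) * (- 1) ^ (m - j))
      * trace_velocity N x ^ j)" for x
    unfolding norm_power_sum_1[OF N] power_mult_distrib m(1)[symmetric]
    using binomial_ring[of "trace_velocity N x" "- 1" m]
    by (simp add: sum_distrib_left mult_ac)
  have "has_expectation s N t (\<lambda>x. \<Sum>j\<le>m. \<i> ^ m * (of_nat (m choose j) * (- 1) ^ (m - j))
      * trace_velocity N x ^ j)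
    (\<Sum>j\<le>m. \<i> ^ m * (of_nat (m choose j) * (- 1) ^ (m - j))
     * nth_vector_derivative j (\<lambda>t. hua_pickrell_E s N (exp_trace N t)) t)"
  proof (intro has_expectation_sum has_expectation_cmult)
    fix j assume "j \<in> {..m}"
    then have "j \<le> K" using m by simp
    then show "has_expectation s N t (\<lambda>x. trace_velocity N x ^ j)
        (nth_vector_derivative j (\<lambda>t. hua_pickrell_E s N (exp_trace N t)) t)"
      unfolding nth_vector_derivative_expectation[OF N s \<open>j \<le> K\<close>]
      using trace_velocity_power_integrable[OF N s] by (simp add: has_expectation_def)
  qed
  moreover have "has_expectation s N t (observable N \<mu>) (moment s N t \<mu>)"
    using has_expectation_observable[OF N s] m by simp
  then have "has_expectation s N t (\<lambda>x. \<Sum>j\<le>m. \<i> ^ m * (of_nat (m choose j) * (- 1) ^ (m - j))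
      * trace_velocity N x ^ j)
     (moment s N t \<mu>)"
    by (rule has_expectation_cong) (simp_all add: obs)
  ultimately show ?thesis by (rule has_expectation_unique[rotated])
qed

section \<open>Degree bounds in the reduction\<close>

lemma poly_in_N_s_mono:
  assumes "poly_in_N_s d g" "d \<le> e"
  shows "poly_in_N_s e g"
  using assms unfolding poly_in_N_s_def by (meson order_trans)

lemma poly_in_N_s_const: "poly_in_N_s d (\<lambda>N s. c)"
  unfolding poly_in_N_s_def by (rule exI[of _ "[:[:c:]:]"]) (auto simp: coeff_pCons split: nat.splits)

lemma poly_in_N_s_N: "poly_in_N_s 1 (\<lambda>N s. of_nat N)"
  unfolding poly_in_N_s_def by (rule exI[of _ "[:0, 1:]"]) (auto simp: coeff_pCons split: nat.splits)

lemma poly_in_N_s_add: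
  assumes "poly_in_N_s d g" "poly_in_N_s d h"
  shows "poly_in_N_s d (\<lambda>N s. g N s + h N s)"
proof -
  from assms obtain p q where
    "degree p \<le> d" "\<forall>a. degree (coeff p a) \<le> d" "\<forall>N s. g N s = poly (poly p [:of_nat N:]) s"
    "degree q \<le> d" "\<forall>a. degree (coeff q a) \<le> d" "\<forall>N s. h N s = poly (poly q [:of_nat N:]) s"
    unfolding poly_in_N_s_def by blast
  then show ?thesis
    unfolding poly_in_N_s_def by (intro exI[of _ "p + q"]) (auto intro: degree_add_le)
qed

lemma poly_in_N_s_mult:
  assumes "poly_in_N_s d g" "poly_in_N_s e h"
  shows "poly_in_N_s (d + e) (\<lambda>N s. g N s * h N s)"
proof -
  from assms obtain p q where
    p: "degree p \<le> d" "\<And>a. degree (coeff p a) \<le> d" "\<forall>N s. g N s = poly (poly p [:of_nat N:]) s" and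
    q: "degree q \<le> e" "\<And>a. degree (coeff q a) \<le> e" "\<forall>N s. h N s = poly (poly q [:of_nat N:]) s"
    unfolding poly_in_N_s_def by blast
  have "degree (coeff (p * q) a) \<le> d + e" for a
    unfolding coeff_mult
    by (intro degree_sum_le order_trans[OF degree_mult_le] add_mono p q) auto
  moreover have "degree (p * q) \<le> d + e"
    by (intro order_trans[OF degree_mult_le] add_mono p q)
  ultimately show ?thesis
    unfolding poly_in_N_s_def using p(3) q(3) by (intro exI[of _ "p * q"]) auto
qed

lemma poly_in_N_s_cmult:
  "poly_in_N_s d g \<Longrightarrow> poly_in_N_s d (\<lambda>N s. c * g N s)"
  using poly_in_N_s_mult[OF poly_in_N_s_const[of 0 c]] by simp

lemma poly_in_N_s_sum:
  assumes "\<And>i. i \<in> A \<Longrightarrow> poly_in_N_s d (g i)"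
  shows "poly_in_N_s d (\<lambda>N s. \<Sum>i\<in>A. g i N s)"
  using assms
  by (induction A rule: infinite_finite_induct) (auto intro: poly_in_N_s_const poly_in_N_s_add)

text \<open>A function of \<open>N\<close>, \<open>s\<close> and \<open>t\<close> is a combination of the derivatives of the characteristic function of
  order at most \<open>\<rho>\<close>, with coefficients that are polynomials of degree at most \<open>e\<close> in \<open>1/t\<close> and at most \<open>d\<close> in
  each of \<open>N\<close> and \<open>s\<close>.  The coefficients are chosen before \<open>N\<close>, \<open>s\<close> and \<open>t\<close>.  The number \<open>K\<close> only fixes the
  half-plane of \<open>s\<close> and stays constant throughout the reduction.\<close>
definition reducible ::
  "nat \<Rightarrow> nat \<Rightarrow> nat \<Rightarrow> nat \<Rightarrow> (nat \<Rightarrow> complex \<Rightarrow> real \<Rightarrow> complex) \<Rightarrow> bool" where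
  "reducible K d \<rho> e \<Phi> \<longleftrightarrow> (\<exists>c. (\<forall>m j. poly_in_N_s d (c m j)) \<and>
     (\<forall>N\<ge>1. \<forall>s. Re s > (real K - 1) / 2 \<longrightarrow> (\<forall>t>0. \<Phi> N s t =
        (\<Sum>m\<le>\<rho>. \<Sum>j\<le>e. c m j N s * (1 / of_real t) ^ j *
           nth_vector_derivative m (\<lambda>t. hua_pickrell_E s N (exp_trace N t)) t))))"

lemma reducibleI:
  assumes "\<And>m j. poly_in_N_s d (c m j)"
    and "\<And>N s t. N \<ge> 1 \<Longrightarrow> Re s > (real K - 1) / 2 \<Longrightarrow> t > 0 \<Longrightarrow> \<Phi> N s t =
        (\<Sum>m\<le>\<rho>. \<Sum>j\<le>e. c m j N s * (1 / of_real t) ^ j *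
           nth_vector_derivative m (\<lambda>t. hua_pickrell_E s N (exp_trace N t)) t)"
  shows "reducible K d \<rho> e \<Phi>"
  using assms unfolding reducible_def by blast

lemma reducibleE:
  assumes "reducible K d \<rho> e \<Phi>"
  obtains c where "\<And>m j. poly_in_N_s d (c m j)"
    and "\<And>N s t. N \<ge> 1 \<Longrightarrow> Re s > (real K - 1) / 2 \<Longrightarrow> t > 0 \<Longrightarrow> \<Phi> N s t =
        (\<Sum>m\<le>\<rho>. \<Sum>j\<le>e. c m j N s * (1 / of_real t) ^ j *
           nth_vector_derivative m (\<lambda>t. hua_pickrell_E s N (exp_trace N t)) t)"
  using assms unfolding reducible_def by blast

lemma reducible_cong:
  assumes "reducible K d \<rho> e \<Phi>"
    and "\<And>N s t. N \<ge> 1 \<Longrightarrow> Re s > (real K - 1) / 2 \<Longrightarrow> t > 0 \<Longrightarrow> \<Psi> N s t = \<Phi> N s t"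
  shows "reducible K d \<rho> e \<Psi>"
  using assms by (elim reducibleE) (auto intro!: reducibleI)

lemma reducible_mono:
  assumes "reducible K d \<rho> e \<Phi>" "d \<le> d'" "\<rho> \<le> \<rho>'" "e \<le> e'"
  shows "reducible K d' \<rho>' e' \<Phi>"
  using assms(1)
proof (rule reducibleE)
  fix c assume c: "\<And>m j. poly_in_N_s d (c m j)"
    and eq: "\<And>N s t. N \<ge> 1 \<Longrightarrow> Re s > (real K - 1) / 2 \<Longrightarrow> t > 0 \<Longrightarrow> \<Phi> N s t =
        (\<Sum>m\<le>\<rho>. \<Sum>j\<le>e. c m j N s * (1 / of_real t) ^ j *
           nth_vector_derivative m (\<lambda>t. hua_pickrell_E s N (exp_trace N t)) t)"
  define c' where "c' = (\<lambda>m j. if m \<le> \<rho> \<and> j \<le> e then c m j else (\<lambda>N s. 0))"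
  show ?thesis
  proof (rule reducibleI[where c = c'])
    show "poly_in_N_s d' (c' m j)" for m j
      using poly_in_N_s_mono[OF c assms(2)] by (auto simp: c'_def intro: poly_in_N_s_const)
    fix N :: nat and s :: complex and t :: real assume "N \<ge> 1" "Re s > (real K - 1) / 2" "t > 0"
    let ?F = "\<lambda>m. nth_vector_derivative m (\<lambda>t. hua_pickrell_E s N (exp_trace N t)) t"
    have "(\<Sum>j\<le>e'. c' m j N s * (1 / of_real t) ^ j * ?F m)
       = (if m \<le> \<rho> then \<Sum>j\<le>e. c m j N s * (1 / of_real t) ^ j * ?F m else 0)" for m
    proof (cases "m \<le> \<rho>")
      case True
      then show ?thesis using assms(4)
        by (simp, intro sum.mono_neutral_cong_right) (auto simp: c'_def)
    qed (simp add: c'_def)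
    then have "(\<Sum>m\<le>\<rho>'. \<Sum>j\<le>e'. c' m j N s * (1 / of_real t) ^ j * ?F m)
       = (\<Sum>m\<le>\<rho>'. if m \<le> \<rho> then \<Sum>j\<le>e. c m j N s * (1 / of_real t) ^ j * ?F m else 0)"
      by simp
    also have "\<dots> = (\<Sum>m\<le>\<rho>. \<Sum>j\<le>e. c m j N s * (1 / of_real t) ^ j * ?F m)"
      using assms(3) by (intro sum.mono_neutral_cong_right) auto
    finally show "\<Phi> N s t = (\<Sum>m\<le>\<rho>'. \<Sum>j\<le>e'. c' m j N s * (1 / of_real t) ^ j * ?F m)"
      using eq \<open>N \<ge> 1\<close> \<open>Re s > (real K - 1) / 2\<close> \<open>t > 0\<close> by simp
  qed
qed

lemma reducible_0: "reducible K d \<rho> e (\<lambda>N s t. 0)"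
  by (rule reducibleI[where c = "\<lambda>m j N s. 0"]) (auto intro: poly_in_N_s_const)

lemma reducible_add:
  assumes "reducible K d \<rho> e \<Phi>" "reducible K d \<rho> e \<Psi>"
  shows "reducible K d \<rho> e (\<lambda>N s t. \<Phi> N s t + \<Psi> N s t)"
  using assms
proof (elim reducibleE)
  fix c c'
  assume "\<And>m j. poly_in_N_s d (c m j)" "\<And>m j. poly_in_N_s d (c' m j)"
    "\<And>N s t. N \<ge> 1 \<Longrightarrow> Re s > (real K - 1) / 2 \<Longrightarrow> t > 0 \<Longrightarrow> \<Phi> N s t =
        (\<Sum>m\<le>\<rho>. \<Sum>j\<le>e. c m j N s * (1 / of_real t) ^ j *
           nth_vector_derivative m (\<lambda>t. hua_pickrell_E s N (exp_trace N t)) t)"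
    "\<And>N s t. N \<ge> 1 \<Longrightarrow> Re s > (real K - 1) / 2 \<Longrightarrow> t > 0 \<Longrightarrow> \<Psi> N s t =
        (\<Sum>m\<le>\<rho>. \<Sum>j\<le>e. c' m j N s * (1 / of_real t) ^ j *
           nth_vector_derivative m (\<lambda>t. hua_pickrell_E s N (exp_trace N t)) t)"
  then show ?thesis
    by (intro reducibleI[where c = "\<lambda>m j N s. c m j N s + c' m j N s"] poly_in_N_s_add)
      (simp_all add: sum.distrib distrib_right)
qed

lemma reducible_sum:
  assumes "\<And>i. i \<in> A \<Longrightarrow> reducible K d \<rho> e (\<Phi> i)"
  shows "reducible K d \<rho> e (\<lambda>N s t. \<Sum>i\<in>A. \<Phi> i N s t)"
  using assms
  by (induction A rule: infinite_finite_induct) (auto intro: reducible_0 reducible_add)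

lemma reducible_sum_mset:
  assumes "\<And>i. i \<in># A \<Longrightarrow> reducible K d \<rho> e (\<Phi> i)"
  shows "reducible K d \<rho> e (\<lambda>N s t. \<Sum>i\<in>#A. \<Phi> i N s t)"
  using assms by (induction A) (auto intro: reducible_0 reducible_add)

lemma reducible_cmult:
  assumes "reducible K d \<rho> e \<Phi>" "poly_in_N_s a g" "a + d \<le> d'"
  shows "reducible K d' \<rho> e (\<lambda>N s t. g N s * \<Phi> N s t)"
  using assms(1)
proof (rule reducibleE)
  fix c
  assume "\<And>m j. poly_in_N_s d (c m j)"
    "\<And>N s t. N \<ge> 1 \<Longrightarrow> Re s > (real K - 1) / 2 \<Longrightarrow> t > 0 \<Longrightarrow> \<Phi> N s t =
        (\<Sum>m\<le>\<rho>. \<Sum>j\<le>e. c m j N s * (1 / of_real t) ^ j *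
           nth_vector_derivative m (\<lambda>t. hua_pickrell_E s N (exp_trace N t)) t)"
  then show ?thesis
    by (intro reducibleI[where c = "\<lambda>m j N s. g N s * c m j N s"]
        poly_in_N_s_mono[OF poly_in_N_s_mult[OF assms(2)] assms(3)])
      (simp_all add: sum_distrib_left mult.assoc)
qed

lemma reducible_divide:
  assumes "reducible K d \<rho> e \<Phi>"
  shows "reducible K d \<rho> (Suc e) (\<lambda>N s t. 1 / of_real t * \<Phi> N s t)"
  using assms(1)
proof (rule reducibleE)
  fix c
  assume c: "\<And>m j. poly_in_N_s d (c m j)"
    "\<And>N s t. N \<ge> 1 \<Longrightarrow> Re s > (real K - 1) / 2 \<Longrightarrow> t > 0 \<Longrightarrow> \<Phi> N s t =
        (\<Sum>m\<le>\<rho>. \<Sum>j\<le>e. c m j N s * (1 / of_real t) ^ j *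
           nth_vector_derivative m (\<lambda>t. hua_pickrell_E s N (exp_trace N t)) t)"
  show ?thesis
  proof (rule reducibleI[where c = "\<lambda>m j N s. case j of 0 \<Rightarrow> 0 | Suc j \<Rightarrow> c m j N s"])
    show "poly_in_N_s d (\<lambda>N s. case j of 0 \<Rightarrow> 0 | Suc j \<Rightarrow> c m j N s)" for m j
      using c(1) by (cases j) (auto intro: poly_in_N_s_const)
  next
    fix N :: nat and s :: complex and t :: real assume h: "N \<ge> 1" "Re s > (real K - 1) / 2" "t > 0"
    show "1 / of_real t * \<Phi> N s t = (\<Sum>m\<le>\<rho>. \<Sum>j\<le>Suc e. (case j of 0 \<Rightarrow> 0 | Suc j \<Rightarrow> c m j N s)
        * (1 / of_real t) ^ j * nth_vector_derivative m (\<lambda>t. hua_pickrell_E s N (exp_trace N t)) t)"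
      unfolding c(2)[OF h] sum_distrib_left sum.atMost_Suc_shift
      by (simp add: mult_ac)
  qed
qed

text \<open>The contribution of a factor \<open>u\<^sub>r\<close> to the order of the derivatives.  The exceptional value at 1
  accounts for \<open>u\<^sub>1\<close> itself being a first-order operator; splitting \<open>u\<^sub>q\<close> into \<open>u\<^sub>a u\<^sub>b\<close> with \<open>a + b < q\<close>
  and merging \<open>u\<^sub>q\<close> with \<open>u\<^sub>r\<close> do not increase the total when \<open>q \<ge> 2\<close>.\<close>
definition derivative_order :: "nat \<Rightarrow> nat" where
  "derivative_order r = (if r = 1 then 1 else r - 1)"

lemma sum_split_ends:
  fixes f :: "nat \<Rightarrow> 'a::comm_monoid_add"
  assumes "m \<ge> 2"
  shows "(\<Sum>a<m. f a) = f 0 + f (m - 1) + (\<Sum>a\<in>{1..<m-1}. f a)"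
proof -
  have "{..<m} = insert 0 (insert (m - 1) {1..<m-1})" using assms by auto
  then show ?thesis using assms by (simp add: add.assoc)
qed

text \<open>The loop equation solved for its leading moment.  The terms of the two sums in which one factor is
  \<open>u\<^sub>0 = 1\<close> have been merged with those carrying \<open>s + N\<close>.  This removes \<open>N\<^sup>2 u\<^bsub>q-1\<^esub>\<close>, whose degree in
  \<open>N\<close> would be too large, and leaves \<open>s N u\<^bsub>q-1\<^esub>\<close>.  For \<open>q = 2\<close> the second sum consists of the
  single term \<open>u\<^sub>0 u\<^sub>0\<close>, which is why the coefficient of \<open>u\<^bsub>q-2\<^esub>\<close> loses its \<open>N\<^sup>2\<close> exactly then.\<close>
lemma moment_reduction:
  assumes N: "N \<ge> 1" and s: "Re s > (real K - 1) / 2" and t: "t > 0"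
    and q: "q \<ge> 2" and K: "q + sum_mset \<mu> \<le> K"
  shows "moment s N t (add_mset q \<mu>) = (- 2 * \<i>) * moment s N t (add_mset (q - 1) \<mu>)
    + 1 / of_real t *
     (((- \<i>) * (of_nat N * of_nat N)) * (\<Sum>a\<in>{1..<q-1}. moment s N t (add_mset a (add_mset (q - Suc a) \<mu>)))
      + (2 * (of_nat N * of_nat N)) * (\<Sum>a\<in>{1..<q-2}. moment s N t (add_mset a (add_mset (q - 1 - Suc a) \<mu>)))
      + ((2 * \<i>) * (s * of_nat N)) * moment s N t (add_mset (q - 1) \<mu>)
      + (if q = 2 then (- 2) * (s * of_nat N) else 2 * (of_nat N * of_nat N) + (- 2) * (s * of_nat N))
         * moment s N t (add_mset (q - 2) \<mu>)
      + (\<Sum>r\<in>#\<mu>. (- \<i> * of_nat r) * moment s N t (add_mset (r + q - 1) (\<mu> - {#r#}))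
          + (2 * of_nat r) * moment s N t (add_mset (r + q - 2) (\<mu> - {#r#}))))"
proof -
  let ?m = "moment s N t"
  define A where "A = (\<Sum>a\<in>{1..<q-1}. ?m (add_mset a (add_mset (q - Suc a) \<mu>)))"
  define B where "B = (\<Sum>a\<in>{1..<q-2}. ?m (add_mset a (add_mset (q - 1 - Suc a) \<mu>)))"
  define C where "C = (\<Sum>r\<in>#\<mu>. of_nat r * (?m (add_mset (r + q - 1) (\<mu> - {#r#}))
          + 2 * \<i> * ?m (add_mset (r + q - 2) (\<mu> - {#r#}))))"
  have A: "(\<Sum>a<q. ?m (add_mset a (add_mset (q - Suc a) \<mu>))) = 2 * ?m (add_mset (q - 1) \<mu>) + A"
    using q by (subst sum_split_ends) (simp_all add: A_def moment_add_mset_0[OF N] add_mset_commute[of _ 0])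
  have B: "(\<Sum>a<q-1. ?m (add_mset a (add_mset (q - 1 - Suc a) \<mu>))) =
      (if q = 2 then 1 else 2) * ?m (add_mset (q - 2) \<mu>) + B"
  proof (cases "q = 2")
    case True
    then show ?thesis by (simp add: B_def moment_add_mset_0[OF N])
  next
    case False
    with q have "q - 1 \<ge> 2" by simp
    moreover have "q - 1 - 1 = q - 2" by simp
    ultimately show ?thesis using False
      by (subst sum_split_ends)
          (simp_all add: B_def moment_add_mset_0[OF N] add_mset_commute[of _ 0] numeral_2_eq_2)
  qed
  have C: "(\<Sum>r\<in>#\<mu>. (- \<i> * of_nat r) * ?m (add_mset (r + q - 1) (\<mu> - {#r#}))
          + (2 * of_nat r) * ?m (add_mset (r + q - 2) (\<mu> - {#r#}))) = - \<i> * C"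
    unfolding C_def sum_mset_distrib_left
    by (intro arg_cong[where f = sum_mset] image_mset_cong) (simp add: algebra_simps)
  define Y where "Y = (of_nat N)\<^sup>2 * ((2 * ?m (add_mset (q - 1) \<mu>) + A)
        + 2 * \<i> * ((if q = 2 then 1 else 2) * ?m (add_mset (q - 2) \<mu>) + B))
     - 2 * (s + of_nat N) * of_nat N * (?m (add_mset (q - 1) \<mu>) + \<i> * ?m (add_mset (q - 2) \<mu>)) + C"
  have "\<i> * of_real t * (?m (add_mset q \<mu>) + 2 * \<i> * ?m (add_mset (q - 1) \<mu>)) = Y"
    using loop_equation[OF N s q K, of t] unfolding A B C_def[symmetric] Y_def .
  then have "- \<i> * (\<i> * of_real t * (?m (add_mset q \<mu>) + 2 * \<i> * ?m (add_mset (q - 1) \<mu>))) = - \<i> * Y"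
    by simp
  then have "of_real t * (?m (add_mset q \<mu>) + 2 * \<i> * ?m (add_mset (q - 1) \<mu>)) = - \<i> * Y"
    by (simp only: mult.assoc[symmetric]) simp
  then have 1: "?m (add_mset q \<mu>) = (- 2 * \<i>) * ?m (add_mset (q - 1) \<mu>) + 1 / of_real t * (- \<i> * Y)"
    using t by (simp add: field_simps)
  have 2: "- \<i> * Y = ((- \<i>) * (of_nat N * of_nat N)) * A
      + (2 * (of_nat N * of_nat N)) * B
      + ((2 * \<i>) * (s * of_nat N)) * ?m (add_mset (q - 1) \<mu>)
      + (if q = 2 then (- 2) * (s * of_nat N) else 2 * (of_nat N * of_nat N) + (- 2) * (s * of_nat N))
         * ?m (add_mset (q - 2) \<mu>) + - \<i> * C"
    unfolding Y_def by (cases "q = 2") (simp_all add: algebra_simps power2_eq_square)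
  show ?thesis
    unfolding C A_def[symmetric] B_def[symmetric] using 1 unfolding 2 .
qed

text \<open>Induction on the weight \<open>\<Sum>\<mu>\<close>.  If some exponent \<open>q \<ge> 2\<close> occurs, each moment on the right of
  \<open>moment_reduction\<close> has smaller weight, and its three bounds fit into those of \<open>\<mu>\<close> after
  allowing for the factor in front of it: replacing \<open>u\<^sub>q\<close> lowers \<open>\<Sum>r\<in>\<mu>. (r - 1)\<close> by at least 2 where it
  brings \<open>N\<^sup>2\<close> and by at least 1 where it brings \<open>s N\<close>, and merging brings no power of \<open>N\<close> or \<open>s\<close>.\<close>
lemma moment_reducible:
  assumes "sum_mset \<mu> \<le> K"
  shows "reducible K (\<Sum>r\<in>#\<mu>. r - 1) (\<Sum>r\<in>#\<mu>. derivative_order r) (sum_mset \<mu> - 1)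
    (\<lambda>N s t. moment s N t \<mu>)"
  using assms
proof (induction \<mu> rule: measure_induct_rule[where f = sum_mset])
  case (less \<mu>0)
  show ?case
  proof (cases "\<forall>r\<in>#\<mu>0. r \<le> 1")
    case True
    define m where "m = sum_mset \<mu>0"
    have ord: "(\<Sum>r\<in>#\<mu>0. derivative_order r) = m"
    proof -
      have "image_mset derivative_order \<mu>0 = image_mset (\<lambda>r. r) \<mu>0"
        using True by (intro image_mset_cong) (auto simp: derivative_order_def le_Suc_eq)
      then show ?thesis by (simp add: m_def)
    qed
    have "reducible K 0 m 0 (\<lambda>N s t. moment s N t \<mu>0)"
    proof (rule reducibleI[where c = "\<lambda>j _ N s. \<i> ^ m * (of_nat (m choose j) * (- 1) ^ (m - j))"])
      fix N :: nat and s :: complex and t :: real assume h: "N \<ge> 1" "Re s > (real K - 1) / 2"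
      have "m \<le> K" using less.prems by (simp add: m_def)
      with moment_ones[OF h _ m_def, of t] True
      show "moment s N t \<mu>0 = (\<Sum>j\<le>m. \<Sum>i\<le>0. \<i> ^ m * (of_nat (m choose j) * (- 1) ^ (m - j)) * (1 / of_real t) ^ i
         * nth_vector_derivative j (\<lambda>t. hua_pickrell_E s N (exp_trace N t)) t)"
        by simp
    qed (rule poly_in_N_s_const)
    then show ?thesis unfolding ord by (rule reducible_mono) auto
  next
    case False
    then obtain q where "q \<in># \<mu>0" and q: "q \<ge> 2" by force
    then obtain \<mu> where \<mu>0: "\<mu>0 = add_mset q \<mu>" by (metis multi_member_split)
    let ?D = "\<lambda>\<mu>. \<Sum>r\<in>#\<mu>. (r::nat) - 1"
    let ?\<rho> = "\<lambda>\<mu>. \<Sum>r\<in>#\<mu>. derivative_order r"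
    define d where "d = ?D \<mu>"
    define \<rho> where "\<rho> = ?\<rho> \<mu>"
    define w where "w = sum_mset \<mu>"
    have K: "q + w \<le> K" using less.prems by (simp add: \<mu>0 w_def)
    \<comment> \<open>The exponent of \<open>1/t\<close> available to the smaller moments is one less than for \<open>\<mu>0\<close>, which
      pays for the division by \<open>t\<close>.\<close>
    have red: "reducible K d' (q - 1 + \<rho>) (q + w - 2) (\<lambda>N s t. moment s N t \<nu>)"
      if "sum_mset \<nu> \<le> q + w - 1" "?D \<nu> \<le> d'" "?\<rho> \<nu> \<le> q - 1 + \<rho>" for \<nu> d'
      by (rule reducible_mono[OF less.IH that(2,3)]) (use that q K in \<open>auto simp: \<mu>0 w_def\<close>)
    note NN = poly_in_N_s_mult[OF poly_in_N_s_N poly_in_N_s_N]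
    \<comment> \<open>An explicit witness: the product rule for degrees would give the bound 2, since it does not see that
      \<open>s\<close> and \<open>N\<close> are different variables.\<close>
    have sN1: "poly_in_N_s 1 (\<lambda>N s. c * (s * of_nat N))" for c
    proof -
      have "degree [:0, [:0, c:]:] \<le> 1" by simp
      moreover have "degree (coeff [:0, [:0, c:]:] a) \<le> 1" for a
        by (auto simp: coeff_pCons split: nat.splits)
      ultimately show ?thesis
        unfolding poly_in_N_s_def by (intro exI[of _ "[:0, [:0, c:]:]"]) auto
    qed
    have NN2: "poly_in_N_s 2 (\<lambda>N s. c * (of_nat N * of_nat N))" for c
      using poly_in_N_s_cmult[OF NN, of c] by (simp add: numeral_2_eq_2)
    have split1: "reducible K (q - 1 + d) (q - 1 + \<rho>) (q + w - 2) (\<lambda>N s t. (c * (of_nat N * of_nat N)) *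
        (\<Sum>a\<in>{1..<q-1}. moment s N t (add_mset a (add_mset (q - Suc a) \<mu>))))" for c
    proof (cases "q \<ge> 3")
      case True
      show ?thesis
      proof (rule reducible_cmult[OF reducible_sum NN2])
        fix a assume "a \<in> {1..<q-1}"
        then show "reducible K (q - 3 + d) (q - 1 + \<rho>) (q + w - 2)
            (\<lambda>N s t. moment s N t (add_mset a (add_mset (q - Suc a) \<mu>)))"
          by (intro red) (auto simp: d_def \<rho>_def w_def derivative_order_def)
      qed (use True in simp)
    next
      case False
      with q have "{1..<q-1} = {}" by simp
      then show ?thesis by (simp add: reducible_0)
    qed
    have split2: "reducible K (q - 1 + d) (q - 1 + \<rho>) (q + w - 2) (\<lambda>N s t. (c * (of_nat N * of_nat N)) *
        (\<Sum>a\<in>{1..<q-2}. moment s N t (add_mset a (add_mset (q - 1 - Suc a) \<mu>))))" for c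
    proof (cases "q \<ge> 4")
      case True
      show ?thesis
      proof (rule reducible_cmult[OF reducible_sum NN2])
        fix a assume "a \<in> {1..<q-2}"
        then show "reducible K (q - 4 + d) (q - 1 + \<rho>) (q + w - 2)
            (\<lambda>N s t. moment s N t (add_mset a (add_mset (q - 1 - Suc a) \<mu>)))"
          by (intro red) (auto simp: d_def \<rho>_def w_def derivative_order_def)
      qed (use True in simp)
    next
      case False
      with q have "{1..<q-2} = {}" by simp
      then show ?thesis by (simp add: reducible_0)
    qed
    have lower: "reducible K (q - 2 + d) (q - 1 + \<rho>) (q + w - 2) (\<lambda>N s t. moment s N t (add_mset (q - 1) \<mu>))"
      using q by (intro red) (auto simp: d_def \<rho>_def w_def derivative_order_def)
    have lower': "reducible K (q - 1 + d) (q - 1 + \<rho>) (q + w - 2) (\<lambda>N s t. (c * (s * of_nat N))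
        * moment s N t (add_mset (q - 1) \<mu>))" for c
      by (rule reducible_cmult[OF lower sN1]) (use q in simp)
    have lower2: "reducible K (q - 1 + d) (q - 1 + \<rho>) (q + w - 2)
      (\<lambda>N s t. (if q = 2 then (- 2) * (s * of_nat N) else 2 * (of_nat N * of_nat N) + (- 2) * (s * of_nat N))
         * moment s N t (add_mset (q - 2) \<mu>))"
    proof (cases "q = 2")
      case True
      have "reducible K (q - 1 + d) (q - 1 + \<rho>) (q + w - 2)
          (\<lambda>N s t. ((- 2) * (s * of_nat N)) * moment s N t (add_mset (q - 2) \<mu>))"
      proof (rule reducible_cmult[OF red sN1])
        show "1 + d \<le> q - 1 + d" using True by simp
      qed (use True in \<open>auto simp: d_def \<rho>_def w_def derivative_order_def\<close>)
      then show ?thesis using True by simp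
    next
      case False
      have "reducible K (q - 1 + d) (q - 1 + \<rho>) (q + w - 2)
          (\<lambda>N s t. (2 * (of_nat N * of_nat N) + (- 2) * (s * of_nat N)) * moment s N t (add_mset (q - 2) \<mu>))"
      proof (rule reducible_cmult[OF red])
        show "poly_in_N_s 2 (\<lambda>N s. 2 * (of_nat N * of_nat N) + (- 2) * (s * of_nat N))"
          by (intro poly_in_N_s_add NN2 poly_in_N_s_mono[OF sN1]) simp
        show "2 + (q - 3 + d) \<le> q - 1 + d" using False q by simp
      qed (use False q in \<open>auto simp: d_def \<rho>_def w_def derivative_order_def\<close>)
      then show ?thesis using False by simp
    qed
    have merge: "reducible K (q - 1 + d) (q - 1 + \<rho>) (q + w - 2) (\<lambda>N s t. c * moment s N t (add_mset (r
        + q - l) (\<mu> - {#r#})))"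
      if r: "r \<in># \<mu>" and l: "l \<in> {1, 2}" for r l c
    proof (rule reducible_cmult[OF red poly_in_N_s_const[of 0]])
      from r obtain \<nu> where \<nu>: "\<mu> = add_mset r \<nu>" by (metis multi_member_split)
      show "sum_mset (add_mset (r + q - l) (\<mu> - {#r#})) \<le> q + w - 1"
        using l q by (auto simp: \<nu> w_def)
      show "?D (add_mset (r + q - l) (\<mu> - {#r#})) \<le> q - 1 + d"
        using l q by (auto simp: \<nu> d_def)
      show "?\<rho> (add_mset (r + q - l) (\<mu> - {#r#})) \<le> q - 1 + \<rho>"
        using l q by (auto simp: \<nu> \<rho>_def derivative_order_def)
    qed simp
    have merge1: "reducible K (q - 1 + d) (q - 1 + \<rho>) (q + w - 2)
       (\<lambda>N s t. \<Sum>r\<in>#\<mu>. (- \<i> * of_nat r) * moment s N t (add_mset (r + q - 1) (\<mu> - {#r#}))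
          + (2 * of_nat r) * moment s N t (add_mset (r + q - 2) (\<mu> - {#r#})))"
      by (intro reducible_sum_mset reducible_add merge) auto
    have same: "reducible K (q - 1 + d) (q - 1 + \<rho>) (Suc (q + w - 2)) (\<lambda>N s t. (- 2 * \<i>)
        * moment s N t (add_mset (q - 1) \<mu>))"
      by (rule reducible_mono[OF reducible_cmult[OF lower poly_in_N_s_const[of 0] order_refl]]) (use q in auto)
    have "reducible K (q - 1 + d) (q - 1 + \<rho>) (Suc (q + w - 2)) (\<lambda>N s t. moment s N t \<mu>0)"
      unfolding \<mu>0
      by (rule reducible_cong[OF reducible_add[OF same reducible_divide[OF reducible_add[OF reducible_add[OF
          reducible_add[OF reducible_add[OF split1 split2] lower'] lower2] merge1]]] moment_reduction])
        (use q K in \<open>auto simp: w_def\<close>)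
    moreover have "?D \<mu>0 = q - 1 + d" "?\<rho> \<mu>0 = q - 1 + \<rho>" "sum_mset \<mu>0 - 1 = Suc (q + w - 2)"
      using q by (auto simp: \<mu>0 d_def \<rho>_def w_def derivative_order_def)
    ultimately show ?thesis by simp
  qed
qed

section \<open>The differential expression\<close>

lemma sum_mset_sum_replicate:
  fixes f :: "'a \<Rightarrow> nat"
  shows "(\<Sum>r\<in>#(\<Sum>q\<in>A. replicate_mset (n q) q). f r) = (\<Sum>q\<in>A. f q * n q)"
  by (induction A rule: infinite_finite_induct) (auto simp: mult.commute)

lemma prod_mset_sum_replicate:
  fixes f :: "'a \<Rightarrow> 'b::comm_monoid_mult"
  shows "(\<Prod>r\<in>#(\<Sum>q\<in>A. replicate_mset (n q) q). f r) = (\<Prod>q\<in>A. f q ^ n q)"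
  by (induction A rule: infinite_finite_induct) (auto simp: prod_mset_constant)

lemma shifted_power_sums_eq_observable:
  assumes "N \<ge> 1"
  shows "shifted_power_sums k n N x = of_nat N ^ (\<Sum>q=2..k. n q) *
    observable N (\<Sum>q=2..k. replicate_mset (n q) q) x"
proof -
  have "(\<Sum>j=1..N. (complex_of_real (x j) - \<i>) ^ q) ^ n q = of_nat N ^ n q * norm_power_sum N q x ^ n q" for q
    using assms by (simp add: norm_power_sum_def power_sum_def power_divide)
  then show ?thesis
    unfolding shifted_power_sums_def observable_def prod_mset_sum_replicate power_sum
    by (simp add: prod.distrib)
qed

theorem theorem1p9:
  fixes k :: nat and n :: "nat \<Rightarrow> nat" and K D :: nat
  assumes "k \<ge> 2"
    and "(\<Sum>q=2..k. n q) > 0"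
    and K: "K = (\<Sum>q=2..k. q * n q)"
    and D: "D = (\<Sum>q=2..k. (q - 1) * n q)"
  shows "\<exists>P :: nat \<Rightarrow> complex \<Rightarrow> nat \<Rightarrow> real \<Rightarrow> complex.
    (\<forall>m\<le>D. \<exists>Q :: nat \<Rightarrow> complex \<Rightarrow> complex poly.
       (\<forall>N s. degree (Q N s) \<le> K - 1) \<and>
       (\<forall>i. poly_in_N_s D (\<lambda>N s. coeff (Q N s) i)) \<and>
       (\<forall>N s t. t \<noteq> 0 \<longrightarrow>
          complex_of_real t powi (int m - 1) * P m s N t = poly (Q N s) (complex_of_real t))) \<and>
    (\<forall>N\<ge>1. \<forall>s. Re s > (real K - 1) / 2 \<longrightarrow>
       (let F = (\<lambda>t. hua_pickrell_E s N (exp_trace N t));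
            L = (\<lambda>t. (- 2 * \<i>) powi (- int K) / of_nat N ^ (\<Sum>q=2..k. n q) *
                   hua_pickrell_E s N (\<lambda>x. exp_trace N t x * shifted_power_sums k n N x));
            R = (\<lambda>t. 1 / complex_of_real t ^ (K - 1) *
                   (\<Sum>m=0..D. complex_of_real t powi (int m - 1) * P m s N t *
                      nth_vector_derivative m F t))
        in (\<forall>t\<ge>0. hua_pickrell_integrable s N (exp_trace N t) \<and>
              hua_pickrell_integrable s N (\<lambda>x. exp_trace N t x * shifted_power_sums k n N x)) \<and>
           (\<forall>m<D. \<forall>t>0. nth_vector_derivative m F differentiable (at t)) \<and>
           (\<forall>t>0. L t = R t) \<and>
           (R \<longlongrightarrow> L 0) (at_right 0)))"
proof -
  define \<nu> where "\<nu> = (\<Sum>q=2..k. replicate_mset (n q) q)"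
  have K': "sum_mset \<nu> = K"
    using sum_mset_sum_replicate[of "\<lambda>r. r" n "{2..k}"] by (simp add: \<nu>_def K)
  have D': "(\<Sum>r\<in>#\<nu>. r - 1) = D"
    unfolding \<nu>_def sum_mset_sum_replicate D ..
  have ord: "(\<Sum>r\<in>#\<nu>. derivative_order r) = D"
    unfolding \<nu>_def sum_mset_sum_replicate D
    by (intro sum.cong) (auto simp: derivative_order_def)
  have "D < K"
  proof -
    have "K = D + (\<Sum>q=2..k. n q)"
      unfolding K D sum.distrib[symmetric]
    proof (rule sum.cong[OF refl])
      fix q assume "q \<in> {2..k}"
      then obtain p where "q = Suc p" by (cases q) auto
      then show "q * n q = (q - 1) * n q + n q" by simp
    qed
    then show ?thesis using assms(2) by simp
  qed
  have "reducible K D D (K - 1) (\<lambda>N s t. moment s N t \<nu>)"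
    using moment_reducible[of \<nu> K] unfolding K' D' ord by simp
  then obtain c where c: "\<And>m j. poly_in_N_s D (c m j)"
    and red: "\<And>N s t. N \<ge> 1 \<Longrightarrow> Re s > (real K - 1) / 2 \<Longrightarrow> t > 0 \<Longrightarrow> moment s N t \<nu> =
        (\<Sum>m\<le>D. \<Sum>j\<le>K - 1. c m j N s * (1 / of_real t) ^ j *
           nth_vector_derivative m (\<lambda>t. hua_pickrell_E s N (exp_trace N t)) t)"
    by (rule reducibleE) blast
  define C where "C = (- 2 * \<i>) powi (- int K)"
  \<comment> \<open>Multiplying by \<open>t\<close> to the power \<open>K - 1\<close> turns polynomials in \<open>1/t\<close> of degree at most \<open>K - 1\<close> into
    polynomials in \<open>t\<close>.\<close>
  define Q where "Q = (\<lambda>m N s. \<Sum>j\<le>K - 1. monom (C * c m j N s) (K - 1 - j))"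
  define P where "P = (\<lambda>m s N t. complex_of_real t powi (1 - int m) * poly (Q m N s) (of_real t))"
  have P: "complex_of_real t powi (int m - 1) * P m s N t = poly (Q m N s) (of_real t)" if "t \<noteq> 0" for m s N t
  proof -
    have "complex_of_real t powi (int m - 1) * of_real t powi (1 - int m) = of_real t powi 0"
      using that by (subst power_int_add[symmetric]) auto
    then show ?thesis by (simp add: P_def mult.assoc[symmetric])
  qed
  have deg: "degree (Q m N s) \<le> K - 1" for m N s
    unfolding Q_def by (intro degree_sum_le order_trans[OF degree_monom_le]) auto
  have coeffs: "poly_in_N_s D (\<lambda>N s. coeff (Q m N s) i)" for m i
    unfolding Q_def coeff_sum coeff_monom
  proof (rule poly_in_N_s_sum)
    fix j
    show "poly_in_N_s D (\<lambda>N s. if K - 1 - j = i then C * c m j N s else 0)"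
      by (cases "K - 1 - j = i") (simp_all add: poly_in_N_s_const poly_in_N_s_cmult c)
  qed
  have Q: "1 / complex_of_real t ^ (K - 1) * poly (Q m N s) (of_real t) = C * (\<Sum>j\<le>K - 1. c m j N s
      * (1 / of_real t) ^ j)"
    if "t > 0" for m N s t
    unfolding Q_def poly_sum poly_monom sum_distrib_left
  proof (rule sum.cong[OF refl])
    fix j assume "j \<in> {..K - 1}"
    then have "K - 1 - j + j = K - 1" by simp
    then have "complex_of_real t ^ (K - 1) = of_real t ^ (K - 1 - j) * of_real t ^ j"
      by (metis power_add)
    then show "1 / complex_of_real t ^ (K - 1) * (C * c m j N s * of_real t ^ (K - 1 - j)) = C
        * (c m j N s * (1 / of_real t) ^ j)"
      using that by (simp add: power_divide)
  qed
  show ?thesis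
  proof (intro exI[of _ P] conjI allI impI)
    fix m
    show "\<exists>Q. (\<forall>N s. degree (Q N s) \<le> K - 1) \<and> (\<forall>i. poly_in_N_s D (\<lambda>N s. coeff (Q N s) i)) \<and>
       (\<forall>N s t. t \<noteq> 0 \<longrightarrow> complex_of_real t powi (int m - 1) * P m s N t = poly (Q N s) (complex_of_real t))"
      using deg coeffs P by (intro exI[of _ "Q m"]) blast
  next
    fix N :: nat and s :: complex
    assume N: "N \<ge> 1" and s: "Re s > (real K - 1) / 2"
    define F where "F = (\<lambda>t. hua_pickrell_E s N (exp_trace N t))"
    define L where "L = (\<lambda>t. (- 2 * \<i>) powi (- int K) / of_nat N ^ (\<Sum>q=2..k. n q) *
       hua_pickrell_E s N (\<lambda>x. exp_trace N t x * shifted_power_sums k n N x))"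
    define R where "R = (\<lambda>t. 1 / complex_of_real t ^ (K - 1) *
       (\<Sum>m=0..D. complex_of_real t powi (int m - 1) * P m s N t * nth_vector_derivative m F t))"
    have sps: "has_expectation s N t (shifted_power_sums k n N) (of_nat N ^ (\<Sum>q=2..k. n q)
        * moment s N t \<nu>)" for t
    proof -
      have "has_expectation s N t (observable N \<nu>) (moment s N t \<nu>)"
        using has_expectation_observable[OF N s] K' by simp
      from has_expectation_cmult[OF this, of "of_nat N ^ (\<Sum>q=2..k. n q)"] show ?thesis
        by (rule has_expectation_cong) (simp_all add: shifted_power_sums_eq_observable[OF N] \<nu>_def)
    qed
    have int1: "hua_pickrell_integrable s N (exp_trace N t)" for t
      using trace_velocity_power_integrable[OF N s, of 0] by simp
    have int2: "hua_pickrell_integrable s N (\<lambda>x. exp_trace N t x * shifted_power_sums k n N x)" for t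
      using sps[of t] by (simp add: has_expectation_def)
    have diff: "nth_vector_derivative m F differentiable (at t)" if "m < D" for m t
    proof -
      have "Suc m \<le> K" "m \<le> K" using that \<open>D < K\<close> by auto
      then show ?thesis
        unfolding F_def nth_vector_derivative_expectation[OF N s \<open>m \<le> K\<close>]
        using vector_derivative_expectation[OF N s] differentiableI_vector by blast
    qed
    have L: "L t = C * moment s N t \<nu>" for t
      using sps[of t] N by (simp add: has_expectation_def L_def C_def)
    have LR: "L t = R t" if t: "t > 0" for t
    proof -
      have "R t = (\<Sum>m=0..D. (1 / complex_of_real t ^ (K - 1) * poly (Q m N s) (of_real t))
          * nth_vector_derivative m F t)"
        unfolding R_def sum_distrib_left
      proof (rule sum.cong[OF refl])
        fix m
        have "t \<noteq> 0" using t by simp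
        from P[OF this, of m s N]
        show "1 / complex_of_real t ^ (K - 1) *
            (complex_of_real t powi (int m - 1) * P m s N t * nth_vector_derivative m F t)
          = 1 / complex_of_real t ^ (K - 1) * poly (Q m N s) (of_real t) * nth_vector_derivative m F t"
          by (simp only: mult.assoc[symmetric])
      qed
      also have "\<dots> = C * moment s N t \<nu>"
        unfolding Q[OF t] red[OF N s t] F_def[symmetric] atLeast0AtMost
        by (simp add: sum_distrib_left sum_distrib_right mult.assoc)
      finally show ?thesis by (simp add: L)
    qed
    \<comment> \<open>The limit at 0 of the right-hand side exists because the left-hand side, which equals it for
      positive \<open>t\<close>, is continuous there.\<close>
    have "isCont L 0"
      unfolding L_def using int2[of 0]
      by (intro continuous_intros continuous_expectation) (simp add: exp_trace_0)
    then have "(L \<longlongrightarrow> L 0) (at_right 0)"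
      by (simp add: isCont_def filterlim_at_split)
    moreover have "\<forall>\<^sub>F t in at_right 0. L t = R t"
      using LR by (auto simp: eventually_at_right_less intro: eventually_mono[OF eventually_at_right_less])
    ultimately have "(R \<longlongrightarrow> L 0) (at_right 0)"
      by (rule Lim_transform_eventually)
    then show "let F = (\<lambda>t. hua_pickrell_E s N (exp_trace N t));
            L = (\<lambda>t. (- 2 * \<i>) powi (- int K) / of_nat N ^ (\<Sum>q=2..k. n q) *
                   hua_pickrell_E s N (\<lambda>x. exp_trace N t x * shifted_power_sums k n N x));
            R = (\<lambda>t. 1 / complex_of_real t ^ (K - 1) *
                   (\<Sum>m=0..D. complex_of_real t powi (int m - 1) * P m s N t *
                      nth_vector_derivative m F t))
        in (\<forall>t\<ge>0. hua_pickrell_integrable s N (exp_trace N t) \<and>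
              hua_pickrell_integrable s N (\<lambda>x. exp_trace N t x * shifted_power_sums k n N x)) \<and>
           (\<forall>m<D. \<forall>t>0. nth_vector_derivative m F differentiable (at t)) \<and>
           (\<forall>t>0. L t = R t) \<and>
           (R \<longlongrightarrow> L 0) (at_right 0)"
      unfolding Let_def F_def[symmetric] L_def[symmetric] R_def[symmetric]
      using int1 int2 diff LR[unfolded R_def] by blast
  qed
qed

end
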